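(* Let $k\ge3$, let $\mathbb{D}\subset\mathbb{R}^2$ be the Euclidean unit disk, and let $\mu$ be the uniform probability measure on $\mathbb{D}$. The minimizers of $$\min_{A\in\{\mathbb{R}^2\}^k}F_\mu(A)\quad\text{subject to}\quad A\subset\mathrm{co}(\mathrm{supp}(\mu))$$ are the collections of extremal points (vertices) of regular $k$-polygons inscribed in $\mathbb{D}$, and they have squared objective value $$F_\mu^2=k\,I\left(\frac{2\pi}{k}\right).$$ The minimizers are unique modulo rotation.
   Context: $\{\mathbb{R}^2\}^k$ denotes the set of unordered collections $A=\{a_\ell\}_{\ell\in[k]}$ of $k$ points of $\mathbb{R}^2$ (repetitions allowed), i.e. $(\mathbb{R}^2)^k$ modulo permutation of components; $[k]=\{1,\dots,k\}$. $\mathrm{co}(\cdot)$ denotes convex hull, $d(x,S)=\inf_{y\in S}\|x-y\|_2$, and $$F_\mu(A)=\left(\int_{\mathbb{R}^2}d^2(x,\mathrm{co}(A))\,d\mu(x)\right)^{1/2}.$$ The function $I:[0,\pi]\to\mathbb{R}$ is defined as follows: for $\alpha\in[0,\pi]$, let $O=(0,0)$, $P=(1,0)$, $Q=(\cos\alpha,\sin\alpha)$, let $\Sigma_\alpha$ be the sector $POQ$ of the unit disk with angle $\alpha$, and let $\triangle_\alpha$ be the triangle with vertices $P,O,Q$; then $$I(\alpha)=\frac1\pi\int_{\Sigma_\alpha}d^2(x,\triangle_\alpha)\,dx=\frac{1}{2\pi}\left(\frac{\alpha}{4}-\frac{13}{12}\sin\alpha+\alpha\cos^2\frac{\alpha}{2}-\frac13\sin\frac{\alpha}{2}\cos^3\frac{\alpha}{2}\right).$$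 *)

theory Defs
  imports "HOL-Analysis.Analysis" "HOL-Library.Multiset"
begin

definition msupport :: "'a::topological_space measure \<Rightarrow> 'a set" where
  "msupport M = {x. \<forall>U. open U \<and> x \<in> U \<longrightarrow> emeasure M U > 0}"

definition unit_disk :: "(real^2) set" where
  "unit_disk = cball 0 1"

definition mu_disk :: "(real^2) measure" where
  "mu_disk = uniform_measure lborel unit_disk"

definition circ :: "real \<Rightarrow> real^2" where
  "circ t = vector [cos t, sin t]"

(* Unordered collections with repetition are multisets.  The Bochner integral is the intended
   one when M has finite second moment (as mu_disk does) and A is nonempty. *)
definition F_obj :: "(real^2) measure \<Rightarrow> (real^2) multiset \<Rightarrow> real" where
  "F_obj M A = sqrt (LINT x|M. (infdist x (convex hull (set_mset A)))\<^sup>2)"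

definition feasible :: "(real^2) measure \<Rightarrow> nat \<Rightarrow> (real^2) multiset \<Rightarrow> bool" where
  "feasible M k A \<longleftrightarrow> size A = k \<and> set_mset A \<subseteq> convex hull (msupport M)"

definition is_minimizer :: "(real^2) measure \<Rightarrow> nat \<Rightarrow> (real^2) multiset \<Rightarrow> bool" where
  "is_minimizer M k A \<longleftrightarrow> is_arg_min (F_obj M) (feasible M k) A"

definition regular_polygon :: "nat \<Rightarrow> (real^2) set \<Rightarrow> bool" where
  "regular_polygon k P \<longleftrightarrow> k \<ge> 3 \<and>
     (\<exists>c r t. r > 0 \<and>
        P = convex hull ((\<lambda>j. c + r *\<^sub>R circ (t + 2 * pi * real j / real k)) ` {..<k}))"

definition vertices :: "(real^2) set \<Rightarrow> (real^2) set" where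
  "vertices P = {x. x extreme_point_of P}"

(* Inscribed in the usual sense: all vertices lie on the boundary of D (not merely in D). *)
definition inscribed_in :: "(real^2) set \<Rightarrow> (real^2) set \<Rightarrow> bool" where
  "inscribed_in P D \<longleftrightarrow> vertices P \<subseteq> frontier D"

definition sector :: "real \<Rightarrow> (real^2) set" where
  "sector a = {r *\<^sub>R circ t | r t. 0 \<le> r \<and> r \<le> 1 \<and> 0 \<le> t \<and> t \<le> a}"

definition triangle :: "real \<Rightarrow> (real^2) set" where
  "triangle a = convex hull {circ 0, 0, circ a}"

definition I_fun :: "real \<Rightarrow> real" where
  "I_fun a = (1 / pi) * (LINT x:sector a|lborel. (infdist x (triangle a))\<^sup>2)"

end

theory Submission
  imports Defs
begin

text \<open>
  By rotation invariance of the disk, the integral of \<open>f\<close> over the disk is the integral of its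
  angular means, so it suffices to minimize the integral of \<open>d(x, co A)\<^sup>2\<close> along each circle of
  radius \<open>r \<le> 1\<close> separately. Sort the directions of the points of \<open>A\<close>; a gap of half-width
  \<open>b \<le> pi / 2\<close> between consecutive directions confines \<open>co A\<close> to a half-plane at distance
  \<open>cos b\<close> from the origin, whose contribution \<open>H (cos b)\<close> bounds that of the gap, with equality
  for regular polygons. As \<open>H\<close> is convex and decreasing and \<open>cos\<close> is concave on \<open>[0, pi / 2]\<close>,
  the function \<open>b \<mapsto> H (cos b)\<close> lies above its tangents, and the half-widths sum to \<open>pi\<close>, so
  equal gaps are optimal. A gap wider than \<open>pi\<close> already costs more than the whole optimum.
  By continuity in \<open>r\<close> a minimizer also attains equality on the unit circle \<open>r = 1\<close>; there the
  tangent bound is strict, so all gaps are equal, and \<open>co A\<close> contains the \<open>k\<close> boundary points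
  of the disk in the gap directions, which must belong to \<open>A\<close>.
\<close>

section \<open>Distances to convex sets in the disk\<close>

lemma circ_nth [simp]: "circ t $ 1 = cos t" "circ t $ 2 = sin t"
  by (simp_all add: circ_def)

lemma inner_circ: "circ s \<bullet> circ t = cos (s - t)"
  by (simp add: inner_vec_def sum_2 cos_diff)

lemma norm_circ [simp]: "norm (circ t) = 1"
  by (simp add: norm_eq_sqrt_inner inner_circ)

lemma circ_periodic [simp]: "circ (t + 2 * pi) = circ t"
  by (simp add: circ_def)

text \<open>Coordinates in the orthonormal frame \<open>circ m\<close>,
  \<open>circ (m + pi / 2)\<close>. With \<open>m\<close> the bisector of a gap, the first
  coordinate is the one that the bounding half-plane constrains.\<close>

lemma circ_add: "circ (m + p) = cos p *\<^sub>R circ m + sin p *\<^sub>R circ (m + pi / 2)"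
  by (simp add: vec_eq_iff forall_2 cos_add sin_add)

lemma circ_add_neq:
  assumes "0 < x" "x < 2 * pi"
  shows "circ (t + x) \<noteq> circ t"
proof
  assume eq: "circ (t + x) = circ t"
  have "cos x = circ (t + x) \<bullet> circ t" by (simp add: inner_circ)
  then have "cos x = 1" by (simp add: eq inner_circ)
  then have "sin (x / 2) = 0" using cos_double_sin[of "x / 2"] by simp
  moreover have "sin (x / 2) > 0" using assms by (intro sin_gt_zero) auto
  ultimately show False by simp
qed

lemma continuous_on_circ [continuous_intros]:
  fixes f :: "'a::t2_space \<Rightarrow> real"
  assumes "continuous_on S f"
  shows "continuous_on S (\<lambda>x. circ (f x))"
proof -
  have "(\<lambda>x. circ (f x)) = (\<lambda>x. cos (f x) *\<^sub>R circ 0 + sin (f x) *\<^sub>R circ (0 + pi / 2))"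
    by (rule ext, subst circ_add[symmetric], simp)
  moreover have "continuous_on S (\<lambda>x. cos (f x) *\<^sub>R circ 0 + sin (f x) *\<^sub>R circ (0 + pi / 2))"
    by (intro continuous_on_add continuous_on_scaleR continuous_on_const
        continuous_on_cos continuous_on_sin assms)
  ultimately show ?thesis by argo
qed

lemma polar_form:
  obtains s where "0 \<le> s" "s < 2 * pi" "x = norm x *\<^sub>R circ s"
proof (cases "x = 0")
  case True
  then show ?thesis using that[of 0] by simp
next
  case False
  have "(norm x)\<^sup>2 = (x $ 1)\<^sup>2 + (x $ 2)\<^sup>2"
    unfolding power2_norm_eq_inner by (simp add: inner_vec_def sum_2 power2_eq_square)
  then have "(x $ 1 / norm x)\<^sup>2 + (x $ 2 / norm x)\<^sup>2 = (norm x)\<^sup>2 / (norm x)\<^sup>2"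
    by (simp only: power_divide add_divide_distrib)
  then have "(x $ 1 / norm x)\<^sup>2 + (x $ 2 / norm x)\<^sup>2 = 1"
    using False by simp
  then obtain s where s: "0 \<le> s" "s < 2 * pi" "x $ 1 / norm x = cos s" "x $ 2 / norm x = sin s"
    using sincos_total_2pi by metis
  have "x = norm x *\<^sub>R circ s"
    using False by (simp add: vec_eq_iff forall_2 flip: s(3,4))
  then show ?thesis using that s(1,2) by blast
qed

lemma extreme_point_of_cball:
  fixes x :: "'a::euclidean_space"
  assumes "dist c x = r"
  shows "x extreme_point_of cball c r"
  unfolding extreme_point_of_def
proof (intro conjI ballI)
  show "x \<in> cball c r" using assms by simp
  fix a b assume "a \<in> cball c r" "b \<in> cball c r"
  then show "x \<notin> open_segment a b"
    using assms dist_decreases_open_segment[of x a b c] by (auto simp: mem_cball)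
qed

text \<open>A point of the sphere is extreme in the ball, hence in every convex subset of the ball
  that contains it, and extreme points of a hull are generators. This later moves points from the
  hull of a configuration into the configuration itself.\<close>

lemma mem_of_mem_convex_hull_cball:
  fixes x :: "'a::euclidean_space"
  assumes "x \<in> convex hull S" "S \<subseteq> cball c r" "dist c x = r"
  shows "x \<in> S"
proof -
  have "convex hull S \<subseteq> cball c r"
    by (simp add: assms(2) hull_minimal)
  then have "x extreme_point_of (convex hull S)"
    using extreme_point_of_cball[OF assms(3)] assms(1) unfolding extreme_point_of_def by blast
  then show ?thesis by (rule extreme_point_of_convex_hull)
qed

text \<open>By Cauchy-Schwarz, going from \<open>x\<close> to a point of \<open>S\<close> lowers the
  inner product with the unit vector \<open>u\<close> by at most the distance travelled. The lower
  bounds on distances to hulls come from here.\<close>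

lemma infdist_halfspace_le:
  fixes u :: "'a::real_inner"
  assumes "S \<noteq> {}" "norm u = 1" "\<And>y. y \<in> S \<Longrightarrow> y \<bullet> u \<le> c"
  shows "max 0 (x \<bullet> u - c) \<le> infdist x S"
proof -
  have "x \<bullet> u - c \<le> dist x y" if "y \<in> S" for y
  proof -
    have "x \<bullet> u - c \<le> (x - y) \<bullet> u"
      using assms(3)[OF that] by (simp add: inner_diff_left)
    also have "\<dots> \<le> dist x y"
      using norm_cauchy_schwarz[of "x - y" u] assms(2) by (simp add: dist_norm)
    finally show ?thesis .
  qed
  then have "x \<bullet> u - c \<le> infdist x S"
    unfolding infdist_notempty[OF assms(1)] by (intro cINF_greatest assms(1)) auto
  then show ?thesis by (simp add: infdist_nonneg)
qed

lemma chord_mem: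
  assumes C: "convex C" "circ (m - b) \<in> C" "circ (m + b) \<in> C"
    and b: "0 < b" "b < pi / 2" and y: "\<bar>y\<bar> \<le> sin b"
  shows "cos b *\<^sub>R circ m + y *\<^sub>R circ (m + pi / 2) \<in> C"
proof -
  have s: "sin b > 0" using b by (simp add: sin_gt_zero2)
  \<comment> \<open>\<open>v\<close> is the affine parameter on the chord: as it runs from 0 to 1,
    the second coordinate \<open>(2 * v - 1) * sin b\<close> runs from \<open>- sin b\<close> to
    \<open>sin b\<close>.\<close>
  define v where "v = (1 + y / sin b) / 2"
  have v: "0 \<le> v" "0 \<le> 1 - v" using y s by (auto simp: v_def field_simps)
  have "(1 - v) *\<^sub>R circ (m - b) + v *\<^sub>R circ (m + b) \<in> C"
    by (rule convexD) (use C v in auto)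
  moreover have "(1 - v) *\<^sub>R circ (m - b) + v *\<^sub>R circ (m + b)
      = cos b *\<^sub>R circ m + ((2 * v - 1) * sin b) *\<^sub>R circ (m + pi / 2)"
  proof -
    have e: "circ (m - b) = cos b *\<^sub>R circ m - sin b *\<^sub>R circ (m + pi / 2)"
      using circ_add[of m "- b"] by simp
    show ?thesis unfolding e circ_add[of m b] by (simp add: vec_eq_iff algebra_simps)
  qed
  moreover have "(2 * v - 1) * sin b = y" using s by (simp add: v_def field_simps)
  ultimately show ?thesis by simp
qed

text \<open>Within the sector, \<open>C\<close> is as close as the half-plane. Beyond the chord, the
  orthogonal projection onto its line still hits the chord, because \<open>r \<le> 1\<close> and
  \<open>\<bar>p\<bar> \<le> b\<close>. Before the chord, the point lies in the triangle spanned by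
  the origin and the chord.\<close>

lemma infdist_sector:
  assumes C: "convex C" "0 \<in> C" "circ (m - b) \<in> C" "circ (m + b) \<in> C"
    and H: "\<And>y. y \<in> C \<Longrightarrow> y \<bullet> circ m \<le> cos b"
    and b: "0 < b" "b < pi / 2" and p: "\<bar>p\<bar> \<le> b" and r: "0 \<le> r" "r \<le> 1"
  shows "infdist (r *\<^sub>R circ (m + p)) C = max 0 (r * cos p - cos b)"
proof (rule antisym)
  have c: "cos b > 0" using b by (intro cos_gt_zero_pi) auto
  have cp: "cos p \<ge> cos b"
    using b p by (subst cos_abs_real[of p, symmetric]) (rule cos_monotone_0_pi_le, auto)
  have sp: "\<bar>sin p\<bar> \<le> sin b"
    using p b sin_monotone_2pi_le[of "-b" p] sin_monotone_2pi_le[of p b] by (auto simp: abs_le_iff)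
  have x: "r *\<^sub>R circ (m + p) = (r * cos p) *\<^sub>R circ m + (r * sin p) *\<^sub>R circ (m + pi / 2)"
    unfolding circ_add[of m p] by (simp add: scaleR_add_right)
  show "infdist (r *\<^sub>R circ (m + p)) C \<le> max 0 (r * cos p - cos b)"
  proof (cases "r * cos p \<ge> cos b")
    case True
    have "\<bar>r * sin p\<bar> \<le> sin b"
      using sp r mult_mono[of r 1 "\<bar>sin p\<bar>" "sin b"] by (simp add: abs_mult)
    then have "cos b *\<^sub>R circ m + (r * sin p) *\<^sub>R circ (m + pi / 2) \<in> C"
      using chord_mem C b by blast
    from infdist_le[OF this, of "r *\<^sub>R circ (m + p)"]
    have "infdist (r *\<^sub>R circ (m + p)) C \<le> norm ((r * cos p - cos b) *\<^sub>R circ m)"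
      by (simp add: x dist_norm algebra_simps)
    then show ?thesis using True by simp
  next
    case False
    \<comment> \<open>The ray from the origin through the point meets the chord at second coordinate
      \<open>y = sin p / cos p * cos b\<close>; \<open>l\<close> is the fraction of the way from the
      origin to that crossing.\<close>
    define l where "l = r * cos p / cos b"
    have cp0: "cos p > 0" using cp c by linarith
    have l: "0 \<le> l" "l \<le> 1" using False r c cp0 by (auto simp: l_def field_simps)
    define y where "y = sin p / cos p * cos b"
    have "\<bar>y\<bar> = \<bar>sin p\<bar> * (cos b / cos p)" using c cp0 by (simp add: y_def abs_mult)
    also have "\<dots> \<le> sin b * 1"
      using sp c cp0 cp by (intro mult_mono) (auto simp: field_simps)
    finally have "cos b *\<^sub>R circ m + y *\<^sub>R circ (m + pi / 2) \<in> C"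
      using chord_mem C b by simp
    then have "l *\<^sub>R (cos b *\<^sub>R circ m + y *\<^sub>R circ (m + pi / 2)) + (1 - l) *\<^sub>R 0 \<in> C"
      by (rule convexD[OF C(1)]) (use C l in auto)
    moreover have "l *\<^sub>R (cos b *\<^sub>R circ m + y *\<^sub>R circ (m + pi / 2)) = r *\<^sub>R circ (m + p)"
      using c cp0 by (simp add: x l_def y_def scaleR_add_right)
    ultimately have "r *\<^sub>R circ (m + p) \<in> C" by simp
    then show ?thesis by simp
  qed
  have "max 0 (r *\<^sub>R circ (m + p) \<bullet> circ m - cos b) \<le> infdist (r *\<^sub>R circ (m + p)) C"
    by (rule infdist_halfspace_le) (use C H in auto)
  then show "max 0 (r * cos p - cos b) \<le> infdist (r *\<^sub>R circ (m + p)) C"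
    by (simp add: inner_circ)
qed

section \<open>Equidistant points on the circle\<close>

text \<open>Multiplied by \<open>2 * sin (d / 2)\<close>, where \<open>d\<close> is the angular
  step, the sum telescopes, and its two ends differ by a full turn. The factor is nonzero because
  \<open>k \<ge> 2\<close> gives \<open>d / 2 < pi\<close>.\<close>

lemma sum_cos_equidistant:
  fixes k :: nat
  assumes "k \<ge> 2"
  shows "(\<Sum>j<k. cos (t + 2 * pi * real j / real k)) = 0"
proof -
  define d where "d = 2 * pi / real k"
  have d: "0 < d / 2" "d / 2 < pi" using assms by (auto simp: d_def field_simps)
  have "2 * sin (d / 2) * (\<Sum>j<k. cos (t + real j * d))
      = (\<Sum>j<k. sin (t + real (Suc j) * d - d / 2) - sin (t + real j * d - d / 2))"
    unfolding sum_distrib_left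
  proof (rule sum.cong)
    fix j
    have e: "t + real (Suc j) * d - d / 2 = (t + real j * d) + d / 2"
      by (simp add: field_simps)
    show "2 * sin (d / 2) * cos (t + real j * d)
        = sin (t + real (Suc j) * d - d / 2) - sin (t + real j * d - d / 2)"
      unfolding e sin_add[of "t + real j * d" "d / 2"] sin_diff[of "t + real j * d" "d / 2"]
      by simp
  qed simp
  also have "\<dots> = sin (t + real k * d - d / 2) - sin (t - d / 2)"
    using sum_lessThan_telescope[of "\<lambda>j. sin (t + real j * d - d / 2)" k] by simp
  also have "t + real k * d - d / 2 = (t - d / 2) + 2 * pi"
    using assms by (simp add: d_def)
  finally have "sin (d / 2) * (\<Sum>j<k. cos (t + real j * d)) = 0" by simp
  moreover have "sin (d / 2) > 0" using d by (rule sin_gt_zero)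
  ultimately show ?thesis by (simp add: d_def mult.commute)
qed

text \<open>The centroid of the points is the origin; sine sums are cosine sums with the phase moved
  by \<open>pi / 2\<close>.\<close>

lemma zero_mem_convex_hull_equidistant:
  fixes k :: nat
  assumes "k \<ge> 2"
  shows "0 \<in> convex hull ((\<lambda>j. circ (t + 2 * pi * real j / real k)) ` {..<k})"
proof -
  have sine: "sin (t + 2 * pi * real j / real k) = cos (t - pi / 2 + 2 * pi * real j / real k)" for j
    using cos_diff[of "t + 2 * pi * real j / real k" "pi / 2"] by (simp add: add_diff_eq diff_add_eq)
  have "(\<Sum>j<k. circ (t + 2 * pi * real j / real k)) = 0"
    using sum_cos_equidistant[OF assms, of t] sum_cos_equidistant[OF assms, of "t - pi / 2"]
    by (simp add: vec_eq_iff forall_2 sine)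
  moreover have "(\<Sum>j<k. (1 / real k) *\<^sub>R circ (t + 2 * pi * real j / real k))
      \<in> convex hull ((\<lambda>j. circ (t + 2 * pi * real j / real k)) ` {..<k})"
    using assms by (intro convex_sum) (auto intro: hull_inc)
  ultimately show ?thesis by (simp flip: scaleR_sum_right)
qed

lemma inj_on_circ_equidistant:
  fixes k :: nat
  assumes "0 < k"
  shows "inj_on (\<lambda>j. circ (t + 2 * pi * real j / real k)) {..<k}"
proof (rule linorder_inj_onI')
  fix i j assume ij: "i \<in> {..<k}" "j \<in> {..<k}" "i < j"
  define x where "x = 2 * pi * ((real j - real i) / real k)"
  have "0 < x" "x < 2 * pi * 1"
    unfolding x_def using ij by (intro mult_pos_pos mult_strict_left_mono; simp add: field_simps)+
  then have "circ (t + 2 * pi * real i / real k + x) \<noteq> circ (t + 2 * pi * real i / real k)"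
    by (intro circ_add_neq) auto
  moreover have "t + 2 * pi * real i / real k + x = t + 2 * pi * real j / real k"
    by (simp add: x_def diff_divide_distrib right_diff_distrib)
  ultimately show "circ (t + 2 * pi * real i / real k) \<noteq> circ (t + 2 * pi * real j / real k)"
    by metis
qed

section \<open>The cost of an angular gap\<close>

text \<open>The squared distance to a half-plane whose boundary is at distance \<open>cos b\<close> from the origin,
  integrated along the circle of radius \<open>r\<close>.\<close>
definition gap_cost :: "real \<Rightarrow> real \<Rightarrow> real" where
  "gap_cost r b = integral {- (pi / 2)..pi / 2} (\<lambda>p. (max 0 (r * cos p - cos b))\<^sup>2)"

lemma gap_cost_integrable:
  fixes r b :: real
  shows "(\<lambda>p. (max 0 (r * cos p - cos b))\<^sup>2) integrable_on {u..v}"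
  by (intro integrable_continuous_real continuous_intros)

text \<open>Strict concavity: by the mean value theorem the difference is governed by
  \<open>- sin z\<close> at a point strictly between \<open>a\<close> and \<open>b\<close>, and sine
  is strictly increasing on the interval.\<close>

lemma cos_less_tangent:
  assumes "a \<in> {0..pi / 2}" "b \<in> {0..pi / 2}" "a \<noteq> b"
  shows "cos b < cos a - sin a * (b - a)"
proof (cases "a < b")
  case True
  then obtain z where z: "a < z" "z < b" "cos b - cos a = (b - a) * (- sin z)"
    using MVT2[of a b cos "\<lambda>x. - sin x"] DERIV_cos by blast
  have "sin a < sin z" using assms z by (intro sin_monotone_2pi) auto
  then have "sin a * (b - a) < sin z * (b - a)" using True by simp
  then show ?thesis using z by (simp add: algebra_simps)
next
  case False
  then have "b < a" using assms by simp
  then obtain z where z: "b < z" "z < a" "cos a - cos b = (a - b) * (- sin z)"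
    using MVT2[of b a cos "\<lambda>x. - sin x"] DERIV_cos by blast
  have "sin z < sin a" using assms z by (intro sin_monotone_2pi) auto
  then have "sin z * (a - b) < sin a * (a - b)" using \<open>b < a\<close> by simp
  then show ?thesis using z by (simp add: algebra_simps)
qed

text \<open>The squared positive part is convex and has derivative \<open>2 * max 0 u\<close>; this
  is its tangent at \<open>u\<close>.\<close>

lemma square_pos_part_tangent:
  fixes u v :: real
  shows "(max 0 u)\<^sup>2 + 2 * max 0 u * (v - u) \<le> (max 0 v)\<^sup>2"
proof (cases "u \<le> 0")
  case False
  then have u: "max 0 u = u" by simp
  have e: "u\<^sup>2 + 2 * u * (v - u) = 2 * u * v - u\<^sup>2"
    by (simp add: power2_eq_square algebra_simps)
  have "2 * u * v - u\<^sup>2 \<le> v\<^sup>2"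
    using zero_le_power2[of "v - u"] by (simp add: power2_diff mult.commute mult.left_commute)
  moreover have "2 * u * v - u\<^sup>2 \<le> 0" if "v \<le> 0"
    using that False mult_nonneg_nonpos[of u v] zero_le_power2[of u] by linarith
  ultimately show ?thesis
    unfolding u e by (auto simp: max_def)
qed simp

text \<open>The tangent inequality for the squared positive part, integrated over \<open>p\<close>,
  is combined with the one for cosine; the latter may be inserted because \<open>S\<close> is
  nonnegative. Strictness is inherited from cosine and needs \<open>S > 0\<close>.\<close>

lemma gap_cost_tangent:
  fixes r b0 :: real
  assumes r: "0 \<le> r" and b0: "b0 \<in> {0..pi / 2}"
  obtains L where "\<And>b. b \<in> {0..pi / 2} \<Longrightarrow> gap_cost r b0 + L * (b - b0) \<le> gap_cost r b"
    and "\<And>b. r = 1 \<Longrightarrow> 0 < b0 \<Longrightarrow> b \<in> {0..pi / 2} \<Longrightarrow> b \<noteq> b0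
      \<Longrightarrow> gap_cost r b0 + L * (b - b0) < gap_cost r b"
proof -
  \<comment> \<open>\<open>- 2 * S\<close> is the derivative in \<open>c = cos b0\<close> of the
    integrated squared distance, so by the chain rule the slope is
    \<open>L = 2 * S * sin b0\<close>.\<close>
  define S where "S = integral {- (pi / 2)..pi / 2} (\<lambda>p. max 0 (r * cos p - cos b0))"
  have int: "(\<lambda>p. max 0 (r * cos p - cos b0)) integrable_on {- (pi / 2)..pi / 2}"
    by (intro integrable_continuous_real continuous_intros)
  have S0: "0 \<le> S"
    unfolding S_def by (intro integral_nonneg int) auto
  \<comment> \<open>For \<open>r = 1\<close> and \<open>b0 > 0\<close> the continuous integrand is
    positive at \<open>p = 0\<close>.\<close>
  have S1: "0 < S" if "r = 1" "0 < b0"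
  proof -
    have "S \<noteq> 0"
    proof
      assume "S = 0"
      then have "\<forall>p\<in>{- (pi / 2)..pi / 2}. max 0 (r * cos p - cos b0) = 0"
        unfolding S_def by (subst (asm) integral_eq_0_iff) (auto intro!: continuous_intros)
      then have "max 0 (r * cos 0 - cos b0) = 0" by (rule bspec) auto
      moreover have "cos b0 < cos 0" using that b0 by (intro cos_monotone_0_pi) auto
      ultimately show False using that by (simp add: max_def split: if_splits)
    qed
    then show ?thesis using S0 by simp
  qed
  have *: "gap_cost r b0 + 2 * S * (cos b0 - cos b) \<le> gap_cost r b" for b
  proof -
    have "gap_cost r b0 + 2 * S * (cos b0 - cos b)
        = integral {- (pi / 2)..pi / 2} (\<lambda>p. (max 0 (r * cos p - cos b0))\<^sup>2
            + max 0 (r * cos p - cos b0) * (2 * (cos b0 - cos b)))"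
      unfolding gap_cost_def S_def
      by (subst integral_add) (auto intro!: integrable_on_mult_left int gap_cost_integrable)
    also have "\<dots> \<le> gap_cost r b"
      unfolding gap_cost_def
    proof (rule integral_le)
      fix p
      show "(max 0 (r * cos p - cos b0))\<^sup>2 + max 0 (r * cos p - cos b0) * (2 * (cos b0 - cos b))
          \<le> (max 0 (r * cos p - cos b))\<^sup>2"
        using square_pos_part_tangent[of "r * cos p - cos b0" "r * cos p - cos b"]
        by (simp add: algebra_simps)
    qed (auto intro!: integrable_add integrable_on_mult_left int gap_cost_integrable)
    finally show ?thesis .
  qed
  show thesis
  proof (rule that[of "2 * S * sin b0"])
    fix b assume b: "b \<in> {0..pi / 2}"
    have "sin b0 * (b - b0) \<le> cos b0 - cos b"
      using cos_less_tangent[OF b0 b] by (cases "b = b0") auto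
    then have "2 * S * (sin b0 * (b - b0)) \<le> 2 * S * (cos b0 - cos b)"
      using S0 by (intro mult_left_mono) auto
    then show "gap_cost r b0 + 2 * S * sin b0 * (b - b0) \<le> gap_cost r b"
      using *[of b] by (simp add: mult.assoc)
  next
    fix b assume b: "r = 1" "0 < b0" "b \<in> {0..pi / 2}" "b \<noteq> b0"
    have "sin b0 * (b - b0) < cos b0 - cos b"
      using cos_less_tangent[OF b0 b(3)] b by auto
    then have "2 * S * (sin b0 * (b - b0)) < 2 * S * (cos b0 - cos b)"
      using S1 b by (intro mult_strict_left_mono) auto
    then show "gap_cost r b0 + 2 * S * sin b0 * (b - b0) < gap_cost r b"
      using *[of b] by (simp add: mult.assoc)
  qed
qed

text \<open>The tangent inequalities at the mean half-width \<open>pi / k\<close> are added up; the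
  linear terms cancel because the half-widths sum to \<open>pi\<close>. For \<open>r = 1\<close> a
  single deviating \<open>b i\<close> makes the sum strict.\<close>

lemma
  fixes k :: nat
  assumes k: "k \<ge> 2" and r: "0 \<le> r"
    and b: "\<And>i. i < k \<Longrightarrow> b i \<in> {0..pi / 2}" and s: "(\<Sum>i<k. b i) = pi"
  shows sum_gap_cost_ge: "real k * gap_cost r (pi / k) \<le> (\<Sum>i<k. gap_cost r (b i))"
    and sum_gap_cost_eqD: "r = 1 \<Longrightarrow> (\<Sum>i<k. gap_cost r (b i)) \<le> real k * gap_cost r (pi / k)
      \<Longrightarrow> i < k \<Longrightarrow> b i = pi / k"
proof -
  have b0: "pi / k \<in> {0..pi / 2}" "0 < pi / k" using k frac_le[of pi pi 2 "real k"] by auto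
  obtain L where L: "\<And>b. b \<in> {0..pi / 2} \<Longrightarrow> gap_cost r (pi / k) + L * (b - pi / k) \<le> gap_cost r b"
    and L1: "\<And>b. r = 1 \<Longrightarrow> 0 < pi / k \<Longrightarrow> b \<in> {0..pi / 2} \<Longrightarrow> b \<noteq> pi / k
      \<Longrightarrow> gap_cost r (pi / k) + L * (b - pi / k) < gap_cost r b"
    using gap_cost_tangent[OF r b0(1)] by blast
  have tot: "(\<Sum>i<k. gap_cost r (pi / k) + L * (b i - pi / k)) = real k * gap_cost r (pi / k)"
    using k s by (simp add: sum.distrib sum_subtractf flip: sum_distrib_left)
  show "real k * gap_cost r (pi / k) \<le> (\<Sum>i<k. gap_cost r (b i))"
    unfolding tot[symmetric] by (intro sum_mono L b) auto
  show "b i = pi / k" if "r = 1" "(\<Sum>i<k. gap_cost r (b i)) \<le> real k * gap_cost r (pi / k)" "i < k"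
  proof (rule ccontr)
    assume "b i \<noteq> pi / k"
    then have "(\<Sum>i<k. gap_cost r (pi / k) + L * (b i - pi / k)) < (\<Sum>i<k. gap_cost r (b i))"
      using L[OF b] L1[OF that(1) b0(2) b[OF that(3)]] that(3)
      by (intro sum_strict_mono_ex1) blast+
    then show False using that tot by simp
  qed
qed

lemma mult_cos_le_1:
  fixes r p :: real
  assumes "0 \<le> r" "r \<le> 1"
  shows "r * cos p \<le> 1"
  using assms mult_left_mono[of "cos p" 1 r] by simp

text \<open>Makes the comparison for gaps wider than \<open>pi\<close> strict on the unit circle,
  which rules them out in the equality case.\<close>

lemma gap_cost_half_pi_pos: "0 < gap_cost 1 (pi / 2)"
proof -
  have "gap_cost 1 (pi / 2) \<noteq> 0"
  proof
    assume "gap_cost 1 (pi / 2) = 0"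
    then have "\<forall>p\<in>{- (pi / 2)..pi / 2}. (max 0 (1 * cos p - cos (pi / 2)))\<^sup>2 = 0"
      unfolding gap_cost_def by (subst (asm) integral_eq_0_iff) (auto intro!: continuous_intros)
    then have "(max 0 (1 * cos 0 - cos (pi / 2)))\<^sup>2 = 0" by (rule bspec) auto
    then show False by simp
  qed
  moreover have "0 \<le> gap_cost 1 (pi / 2)"
    unfolding gap_cost_def by (intro integral_nonneg gap_cost_integrable) auto
  ultimately show ?thesis by simp
qed

text \<open>Since \<open>r cos p \<le> 1\<close>, passing from a half-plane through the origin to the half-plane at
  distance \<open>cos (pi / 3) = 1 / 2\<close> at least halves the distances.\<close>
lemma gap_cost_pi_third_le:
  assumes r: "0 \<le> r" "r \<le> 1"
  shows "4 * gap_cost r (pi / 3) \<le> gap_cost r (pi / 2)"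
proof -
  have "4 * gap_cost r (pi / 3)
      = integral {- (pi / 2)..pi / 2} (\<lambda>p. 4 * (max 0 (r * cos p - cos (pi / 3)))\<^sup>2)"
    unfolding gap_cost_def by simp
  also have "\<dots> \<le> gap_cost r (pi / 2)"
    unfolding gap_cost_def
  proof (rule integral_le)
    fix p :: real
    have "2 * max 0 (r * cos p - cos (pi / 3)) \<le> max 0 (r * cos p - cos (pi / 2))"
      using mult_cos_le_1[OF r, of p] by (auto simp: cos_60 max_def)
    then have "(2 * max 0 (r * cos p - cos (pi / 3)))\<^sup>2 \<le> (max 0 (r * cos p - cos (pi / 2)))\<^sup>2"
      by (intro power_mono) auto
    then show "4 * (max 0 (r * cos p - cos (pi / 3)))\<^sup>2 \<le> (max 0 (r * cos p - cos (pi / 2)))\<^sup>2"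
      by (simp add: power_mult_distrib)
  qed (intro integrable_on_mult_right gap_cost_integrable)+
  finally show ?thesis .
qed

lemma gap_cost_0:
  assumes "0 \<le> r" "r \<le> 1"
  shows "gap_cost r 0 = 0"
  using mult_cos_le_1[OF assms] by (simp add: gap_cost_def max_absorb1)

text \<open>A configuration with a gap wider than \<open>pi\<close> is compared with the one having three gaps of
  \<open>2 pi / 3\<close> and \<open>k - 3\<close> empty ones.\<close>
lemma gap_cost_half_pi_ge:
  fixes k :: nat
  assumes k: "k \<ge> 3" and r: "0 \<le> r" "r \<le> 1"
  shows "4 * (real k * gap_cost r (pi / k)) \<le> 3 * gap_cost r (pi / 2)"
proof -
  have *: "(\<Sum>i<k. if i < 3 then c else 0) = 3 * c" for c :: real
  proof -
    have "(\<Sum>i<k. if i < 3 then c else 0) = (\<Sum>i\<in>{..<3::nat}. c)"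
      using k by (intro sum.mono_neutral_cong_right) auto
    then show ?thesis by simp
  qed
  have "real k * gap_cost r (pi / k) \<le> (\<Sum>i<k. gap_cost r (if i < 3 then pi / 3 else 0))"
    using k r by (intro sum_gap_cost_ge) (auto simp: *)
  also have "\<dots> = (\<Sum>i<k. if i < 3 then gap_cost r (pi / 3) else 0)"
    by (intro sum.cong) (auto simp: gap_cost_0[OF r])
  finally show ?thesis using gap_cost_pi_third_le[OF r] by (simp add: *)
qed

section \<open>Integrals of periodic functions and over partitions\<close>

lemma integral_shift_real:
  fixes f :: "real \<Rightarrow> real"
  shows "integral {a + c..b + c} f = integral {a..b} (\<lambda>x. f (c + x))"
  using integral_shift_cbox_plus[of a b f c] by (simp add: o_def)

text \<open>Both windows complete to a common interval, and the two leftover pieces are translates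
  of each other by \<open>p\<close>.\<close>

lemma integral_periodic:
  fixes f :: "real \<Rightarrow> real"
  assumes per: "\<And>x. f (x + p) = f x" and p: "0 \<le> p" and int: "\<And>a b. f integrable_on {a..b}"
  shows "integral {a..a + p} f = integral {0..p} f"
proof -
  have sh: "integral {u + p..v + p} f = integral {u..v} f" for u v
    unfolding integral_shift_real by (simp add: add.commute[of p] per)
  note comb = Henstock_Kurzweil_Integration.integral_combine[OF _ _ int]
  show ?thesis
  proof (cases "0 \<le> a")
    case True
    have "integral {0..a} f + integral {a..a + p} f = integral {0..p} f + integral {p..a + p} f"
      using comb[of 0 a "a + p"] comb[of 0 p "a + p"] True p by simp
    then show ?thesis using sh[of 0 a] by simp
  next
    case False
    have "integral {a..0} f + integral {0..p} f = integral {a..a + p} f + integral {a + p..p} f"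
      using comb[of a 0 p] comb[of a "a + p" p] False p by simp
    then show ?thesis using sh[of a 0] by simp
  qed
qed

lemma integral_eq_sum_partition:
  fixes f :: "real \<Rightarrow> real"
  assumes int: "\<And>a b. f integrable_on {a..b}" and "\<And>i. i < k \<Longrightarrow> t i \<le> t (Suc i)"
  shows "integral {t 0..t k} f = (\<Sum>i<k. integral {t i..t (Suc i)} f)"
  using assms(2)
proof (induction k)
  case (Suc k)
  have "t 0 \<le> t j" if "j \<le> k" for j
    using that by (induction j) (auto intro: order_trans[OF _ Suc.prems])
  then have "integral {t 0..t (Suc k)} f = integral {t 0..t k} f + integral {t k..t (Suc k)} f"
    using Henstock_Kurzweil_Integration.integral_combine[OF _ _ int, of "t 0" "t k" "t (Suc k)"]
      Suc.prems[of k] by simp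
  then show ?case using Suc by simp
qed simp

section \<open>Gap costs as integrals along circles\<close>

text \<open>For \<open>b \<le> \<bar>p\<bar> \<le> pi / 2\<close> the integrand vanishes, since
  \<open>r * cos p \<le> cos p \<le> cos b\<close>. The cost is thus charged to the arc of the gap
  itself, and the costs of consecutive gaps can be added.\<close>

lemma gap_cost_eq:
  assumes b: "0 \<le> b" "b \<le> pi / 2" and r: "0 \<le> r" "r \<le> 1"
  shows "gap_cost r b = integral {m - b..m + b} (\<lambda>s. (max 0 (r * cos (s - m) - cos b))\<^sup>2)"
proof -
  let ?f = "\<lambda>p. (max 0 (r * cos p - cos b))\<^sup>2"
  have zero: "?f p = 0" if "b \<le> \<bar>p\<bar>" "\<bar>p\<bar> \<le> pi / 2" for p
  proof -
    have "cos p \<le> cos b"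
      using that b by (subst cos_abs_real[of p, symmetric]) (rule cos_monotone_0_pi_le, auto)
    moreover have "0 \<le> cos p" using that by (intro cos_ge_zero) auto
    ultimately have "r * cos p \<le> cos b" using r mult_left_le_one_le[of "cos p" r] by linarith
    then show ?thesis by simp
  qed
  note comb = Henstock_Kurzweil_Integration.integral_combine[OF _ _ gap_cost_integrable]
  have "gap_cost r b = integral {- (pi / 2)..- b} ?f + integral {- b..b} ?f + integral {b..pi / 2} ?f"
    unfolding gap_cost_def
    using comb[of "- (pi / 2)" "- b" "pi / 2" r b] comb[of "- b" b "pi / 2" r b] b by simp
  also have "integral {- (pi / 2)..- b} ?f = 0"
    using b by (subst integral_cong[OF zero]) auto
  also have "integral {b..pi / 2} ?f = 0"
    using b by (subst integral_cong[OF zero]) auto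
  also have "integral {- b..b} ?f = integral {m - b..m + b} (\<lambda>s. (max 0 (r * cos (s - m) - cos b))\<^sup>2)"
    using integral_shift_real[of "- b" m b "\<lambda>s. (max 0 (r * cos (s - m) - cos b))\<^sup>2"]
    by (simp add: add.commute)
  finally show ?thesis by simp
qed

definition angular :: "(real^2) set \<Rightarrow> real \<Rightarrow> real \<Rightarrow> real" where
  "angular K r s = (infdist (r *\<^sub>R circ s) K)\<^sup>2"

lemma continuous_on_angular [continuous_intros]: "continuous_on S (angular K r)"
  unfolding angular_def by (intro continuous_intros)

lemma angular_integrable: "angular K r integrable_on {a..b}"
  by (intro integrable_continuous_real continuous_intros)

lemma angular_ge:
  assumes "K \<noteq> {}" "\<And>y. y \<in> K \<Longrightarrow> y \<bullet> circ m \<le> c"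
  shows "(max 0 (r * cos (s - m) - c))\<^sup>2 \<le> angular K r s"
proof -
  have "max 0 (r *\<^sub>R circ s \<bullet> circ m - c) \<le> infdist (r *\<^sub>R circ s) K"
    by (rule infdist_halfspace_le) (use assms in auto)
  then show ?thesis unfolding angular_def by (intro power_mono) (auto simp: inner_circ)
qed

lemma integral_angular_gap_ge:
  assumes "K \<noteq> {}" "\<And>y. y \<in> K \<Longrightarrow> y \<bullet> circ m \<le> cos b"
    and b: "0 \<le> b" "b \<le> pi / 2" and r: "0 \<le> r" "r \<le> 1"
  shows "gap_cost r b \<le> integral {m - b..m + b} (angular K r)"
  unfolding gap_cost_eq[OF b r, of m]
  by (intro integral_le angular_integrable integrable_continuous_real continuous_intros
      angular_ge[OF assms(1,2)])

text \<open>The case of equality in \<open>integral_angular_gap_ge\<close>: with the origin and both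
  ends of the chord in \<open>C\<close>, distances in the sector are those to the
  half-plane.\<close>

lemma integral_angular_sector:
  assumes C: "convex C" "0 \<in> C" "circ (m - b) \<in> C" "circ (m + b) \<in> C"
    and H: "\<And>y. y \<in> C \<Longrightarrow> y \<bullet> circ m \<le> cos b"
    and b: "0 < b" "b < pi / 2" and r: "0 \<le> r" "r \<le> 1"
  shows "integral {m - b..m + b} (angular C r) = gap_cost r b"
proof -
  have "gap_cost r b = integral {m - b..m + b} (\<lambda>s. (max 0 (r * cos (s - m) - cos b))\<^sup>2)"
    using b r by (intro gap_cost_eq) auto
  also have "\<dots> = integral {m - b..m + b} (angular C r)"
  proof (rule integral_cong)
    fix s assume "s \<in> {m - b..m + b}"
    then show "(max 0 (r * cos (s - m) - cos b))\<^sup>2 = angular C r s"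
      using infdist_sector[OF C H b _ r, of "s - m"] by (auto simp: angular_def)
  qed
  finally show ?thesis ..
qed

section \<open>Point configurations on a fixed circle\<close>

text \<open>The integral over the circle, not its mean; the division by \<open>2 * pi\<close> is
  kept outside.\<close>

definition radial :: "(real^2) set \<Rightarrow> real \<Rightarrow> real" where
  "radial K r = integral {0..2 * pi} (angular K r)"

text \<open>Directions are only determined modulo \<open>2 pi\<close>; for each gap the representative \<open>s\<close> is taken in
  the interval of length \<open>2 pi\<close> ending at \<open>t (i + 1)\<close>, so that it lies to the left of the gap.\<close>
definition gap_partition :: "nat \<Rightarrow> (nat \<Rightarrow> real) \<Rightarrow> (real^2) set \<Rightarrow> bool" where
  "gap_partition k t S \<longleftrightarrow> (\<forall>i<k. t i \<le> t (Suc i)) \<and> t k = t 0 + 2 * pi \<and>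
     (\<forall>a\<in>S. \<forall>i<k. \<exists>q s. 0 \<le> q \<and> q \<le> 1 \<and> a = q *\<^sub>R circ s \<and> t (Suc i) - 2 * pi \<le> s \<and> s \<le> t i)"

text \<open>With bisector \<open>m\<close> and half-width \<open>b\<close>, the chosen
  representative \<open>s\<close> of a direction satisfies
  \<open>b \<le> m - s \<le> 2 * pi - b\<close>, hence \<open>cos (m - s) \<le> cos b\<close>. The
  \<open>max 0\<close> accounts for points near the origin, where the factor \<open>q\<close>
  shrinks a negative inner product towards 0.\<close>

lemma gap_partition_halfspace:
  assumes "gap_partition k t S" "i < k" "y \<in> convex hull S"
  shows "y \<bullet> circ ((t i + t (Suc i)) / 2) \<le> max 0 (cos ((t (Suc i) - t i) / 2))"
proof -
  define m b where "m = (t i + t (Suc i)) / 2" and "b = (t (Suc i) - t i) / 2"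
  have mb: "t i = m - b" "t (Suc i) = m + b" by (auto simp: m_def b_def field_simps)
  have b: "0 \<le> b" using assms unfolding gap_partition_def b_def by auto
  have "S \<subseteq> {x. circ m \<bullet> x \<le> max 0 (cos b)}"
  proof
    fix a assume "a \<in> S"
    then obtain q s where q: "0 \<le> q" "q \<le> 1" "a = q *\<^sub>R circ s"
      and s: "t (Suc i) - 2 * pi \<le> s" "s \<le> t i"
      using assms unfolding gap_partition_def by blast
    have "cos (m - s) \<le> cos b"
    proof (cases "m - s \<le> pi")
      case True
      then show ?thesis using s b mb by (intro cos_monotone_0_pi_le) auto
    next
      case False
      have "cos (2 * pi - (m - s)) \<le> cos b"
        using False s b mb by (intro cos_monotone_0_pi_le) auto
      then show ?thesis using cos_2pi_minus by metis
    qed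
    moreover have "q * cos (m - s) \<le> max 0 (cos (m - s))"
      using q mult_left_le_one_le[of "cos (m - s)" q] mult_nonneg_nonpos[of q "cos (m - s)"]
      by (cases "0 \<le> cos (m - s)") auto
    ultimately show "a \<in> {x. circ m \<bullet> x \<le> max 0 (cos b)}"
      by (auto simp: q inner_circ max_def split: if_splits)
  qed
  then have "convex hull S \<subseteq> {x. circ m \<bullet> x \<le> max 0 (cos b)}"
    by (intro hull_minimal convex_halfspace_le)
  then show ?thesis using assms(3) by (auto simp: m_def b_def inner_commute)
qed

lemma radial_partition:
  assumes "\<And>i. i < k \<Longrightarrow> t i \<le> t (Suc i)" "t k = t 0 + 2 * pi"
  shows "radial K r = (\<Sum>i<k. integral {t i..t (Suc i)} (angular K r))"
proof -
  have "radial K r = integral {t 0..t 0 + 2 * pi} (angular K r)"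
    unfolding radial_def
    by (rule integral_periodic[symmetric]) (simp_all add: angular_integrable, simp add: angular_def)
  then show ?thesis
    using integral_eq_sum_partition[of "angular K r" k t] assms by (simp add: angular_integrable)
qed

text \<open>Either some gap is wider than \<open>pi\<close> and alone pays
  \<open>gap_cost r (pi / 2)\<close>, or each gap pays at least its own cost and the tangent
  inequality applies. Equality at \<open>r = 1\<close> excludes the first case and forces equality
  in every term of the second.\<close>

lemma
  fixes k :: nat
  assumes k: "k \<ge> 3" and gp: "gap_partition k t S" and S: "S \<noteq> {}" and fin: "finite S" and r: "0 \<le> r" "r \<le> 1"
  shows radial_ge: "real k * gap_cost r (pi / k) \<le> radial (convex hull S) r"
    and radial_le_eqD: "r = 1 \<Longrightarrow> radial (convex hull S) r \<le> real k * gap_cost r (pi / k)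
      \<Longrightarrow> i < k \<Longrightarrow> t (Suc i) = t i + 2 * pi / k \<and> circ (t i) \<in> convex hull S"
proof -
  let ?K = "convex hull S"
  define m b where "m i = (t i + t (Suc i)) / 2" and "b i = (t (Suc i) - t i) / 2" for i
  have tl: "t i = m i - b i" for i by (simp add: m_def b_def field_simps)
  have mb: "{t i..t (Suc i)} = {m i - b i..m i + b i}" for i by (auto simp: m_def b_def field_simps)
  have K: "?K \<noteq> {}" using S by simp
  have mono: "t i \<le> t (Suc i)" if "i < k" for i
    using gp that unfolding gap_partition_def by blast
  have b0: "0 \<le> b i" if "i < k" for i using mono[OF that] by (simp add: b_def)
  have tk: "t k = t 0 + 2 * pi" using gp unfolding gap_partition_def by blast
  have half: "y \<bullet> circ (m i) \<le> max 0 (cos (b i))" if "i < k" "y \<in> ?K" for i y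
    using gap_partition_halfspace[OF gp that] by (simp add: m_def b_def)
  have nonneg: "0 \<le> integral A (angular ?K r)" for A
    by (cases "angular ?K r integrable_on A")
      (auto intro: integral_nonneg simp: angular_def not_integrable_integral)
  have rad: "radial ?K r = (\<Sum>i<k. integral {t i..t (Suc i)} (angular ?K r))"
    using radial_partition[OF mono tk] by blast
  have sb: "(\<Sum>i<k. b i) = pi"
    using sum_lessThan_telescope[of t k] tk by (simp add: b_def flip: sum_divide_distrib)
  \<comment> \<open>Only the half-circle around the bisector is charged. It lies inside the gap
    because \<open>b i > pi / 2\<close>, and the half-plane through the origin bounds the hull
    there.\<close>
  have big: "gap_cost r (pi / 2) \<le> radial ?K r" if "i < k" "pi / 2 < b i" for i
  proof -
    have "gap_cost r (pi / 2) \<le> integral {m i - pi / 2..m i + pi / 2} (angular ?K r)"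
    proof (rule integral_angular_gap_ge[OF K])
      fix y assume "y \<in> ?K"
      \<comment> \<open>The half-widths are nonnegative with sum \<open>pi\<close>; this keeps
        \<open>b i\<close> in the range where cosine decreases.\<close>
      have "b i \<le> pi"
        using sb member_le_sum[of i "{..<k}" b] b0 that by auto
      then have "cos (b i) \<le> cos (pi / 2)" using that by (intro cos_monotone_0_pi_le) auto
      then show "y \<bullet> circ (m i) \<le> cos (pi / 2)" using half[OF that(1) \<open>y \<in> ?K\<close>] by simp
    qed (use r in auto)
    also have "\<dots> \<le> integral {t i..t (Suc i)} (angular ?K r)"
      using that unfolding mb
      by (intro integral_subset_le angular_integrable) (auto simp: angular_def)
    also have "\<dots> \<le> radial ?K r"
      unfolding rad using that(1) nonneg by (intro member_le_sum) auto
    finally show ?thesis .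
  qed
  have small: "gap_cost r (b i) \<le> integral {t i..t (Suc i)} (angular ?K r)"
    if "i < k" "b i \<le> pi / 2" for i
    unfolding mb
  proof (rule integral_angular_gap_ge[OF K])
    fix y assume "y \<in> ?K"
    moreover have "0 \<le> cos (b i)" using b0[OF that(1)] that(2) pi_ge_zero by (intro cos_ge_zero) linarith+
    ultimately show "y \<bullet> circ (m i) \<le> cos (b i)" using half[OF that(1)] by fastforce
  qed (use that b0 r in auto)
  have gc0: "0 \<le> gap_cost r c" for c
    unfolding gap_cost_def by (intro integral_nonneg gap_cost_integrable) auto
  show ge: "real k * gap_cost r (pi / k) \<le> radial ?K r"
  proof (cases "\<exists>i<k. pi / 2 < b i")
    case True
    then obtain i where "i < k" "pi / 2 < b i" by blast
    from big[OF this] show ?thesis using gap_cost_half_pi_ge[OF k r] gc0[of "pi / 2"] by linarith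
  next
    case False
    have "real k * gap_cost r (pi / k) \<le> (\<Sum>i<k. gap_cost r (b i))"
      using k r False b0 sb by (intro sum_gap_cost_ge) auto
    also have "\<dots> \<le> radial ?K r" unfolding rad using False by (intro sum_mono small) auto
    finally show ?thesis .
  qed
  show "t (Suc i) = t i + 2 * pi / k \<and> circ (t i) \<in> ?K"
    if r1: "r = 1" and le: "radial ?K r \<le> real k * gap_cost r (pi / k)" and i: "i < k"
  proof -
    \<comment> \<open>With \<open>G = gap_cost 1 (pi / 2) > 0\<close> and \<open>X\<close> the
      optimum, a wide gap would give \<open>G \<le> X\<close> next to
      \<open>4 * X \<le> 3 * G\<close>.\<close>
    have nb: "b j \<le> pi / 2" if "j < k" for j
      using big[OF that] le gap_cost_half_pi_ge[OF k r] gap_cost_half_pi_pos r1 by fastforce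
    have sum_le: "(\<Sum>i<k. gap_cost r (b i)) \<le> radial ?K r"
      unfolding rad using nb by (intro sum_mono small) auto
    have bi: "b j = pi / k" if "j < k" for j
      by (rule sum_gap_cost_eqD[of k r b j]) (use k r nb b0 sb sum_le le r1 that in auto)
    \<comment> \<open>The gap costs already add up to the optimum, so no arc may exceed its own
      bound.\<close>
    have "integral {t i..t (Suc i)} (angular ?K r) \<le> gap_cost r (b i)"
    proof (rule ccontr)
      assume "\<not> ?thesis"
      then have "(\<Sum>i<k. gap_cost r (b i)) < radial ?K r"
        unfolding rad using small nb i by (intro sum_strict_mono_ex1) (auto simp: not_le)
      moreover have "(\<Sum>i<k. gap_cost r (b i)) = real k * gap_cost r (pi / k)"
        using bi by simp
      ultimately show False using le by simp
    qed
    then have int: "integral {t i..t (Suc i)} (angular ?K r) = gap_cost r (b i)"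
      using small[OF i nb[OF i]] by simp
    have tt: "t i < t (Suc i)" 
    proof -
      have "0 < b i" unfolding bi[OF i] using k by simp
      then show ?thesis by (simp add: b_def)
    qed
    \<comment> \<open>\<open>?g\<close> is the squared distance to the half-plane of the gap. It is
      a continuous lower bound of \<open>angular ?K r\<close> with the same integral over the arc,
      so the two agree everywhere on it. At the endpoint \<open>t i\<close> it is zero, which puts
      \<open>circ (t i)\<close> into the closed hull.\<close>
    let ?g = "\<lambda>s. (max 0 (r * cos (s - m i) - cos (b i)))\<^sup>2"
    have g_int: "?g integrable_on {t i..t (Suc i)}"
      by (intro integrable_continuous_real continuous_intros)
    have cb: "0 \<le> cos (b i)" using b0[OF i] nb[OF i] pi_ge_zero by (intro cos_ge_zero) linarith+
    have "integral {t i..t (Suc i)} (\<lambda>s. angular ?K r s - ?g s) = 0"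
      using int gap_cost_eq[OF b0[OF i] nb[OF i] r, of "m i"]
      by (subst integral_diff[OF angular_integrable g_int]) (simp add: mb)
    moreover have "?g s \<le> angular ?K r s" for s
      using angular_ge[OF K, of "m i" "cos (b i)"] half[OF i] cb by (simp add: max_absorb2)
    ultimately have "\<forall>s\<in>{t i..t (Suc i)}. angular ?K r s - ?g s = 0"
      by (subst (asm) integral_eq_0_iff) (auto intro!: continuous_intros tt)
    then have "angular ?K r (t i) = ?g (t i)" using tt by auto
    also have "\<dots> = 0" using cb r1 by (simp add: tl)
    finally have "infdist (circ (t i)) ?K = 0" using r1 by (simp add: angular_def)
    moreover have "closed ?K"
      using fin by (simp add: compact_imp_closed finite_imp_compact_convex_hull)
    ultimately have "circ (t i) \<in> ?K" using K by (simp add: in_closed_iff_infdist_zero)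
    moreover have "t (Suc i) = t i + 2 * pi / k" using bi[OF i] by (simp add: b_def field_simps)
    ultimately show ?thesis by simp
  qed
qed

section \<open>Regular polygons inscribed in the unit circle\<close>

definition gon :: "nat \<Rightarrow> real \<Rightarrow> (real^2) set" where
  "gon k t = (\<lambda>j. circ (t + 2 * pi * real j / real k)) ` {..<k}"

lemma gap_partition_gon:
  assumes "0 < k"
  shows "gap_partition k (\<lambda>i. t + 2 * pi * real i / real k) (gon k t)"
  unfolding gap_partition_def
proof (intro conjI ballI allI impI)
  fix i
  show "t + 2 * pi * real i / real k \<le> t + 2 * pi * real (Suc i) / real k"
    by (intro add_left_mono divide_right_mono mult_left_mono) auto
next
  show "t + 2 * pi * real k / real k = t + 2 * pi * real 0 / real k + 2 * pi"
    using assms by simp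
next
  fix a i assume a: "a \<in> gon k t" and i: "i < k"
  then obtain j where j: "j < k" "a = circ (t + 2 * pi * real j / real k)"
    unfolding gon_def by auto
  \<comment> \<open>Vertices after the gap are moved back by a full turn, that is, by
    \<open>k\<close> index steps.\<close>
  define s where "s = (if j \<le> i then t + 2 * pi * real j / real k else t + 2 * pi * (real j - real k) / real k)"
  have le: "t + 2 * pi * u / real k \<le> t + 2 * pi * v / real k" if "u \<le> v" for u v
    using that by (intro add_left_mono divide_right_mono mult_left_mono) auto
  have e: "t + 2 * pi * (u - real k) / real k = t + 2 * pi * u / real k - 2 * pi" for u
    using assms by (simp add: diff_divide_distrib right_diff_distrib)
  have "circ s = a"
    using j circ_periodic[of "t + 2 * pi * real j / real k - 2 * pi"] unfolding s_def e by simp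
  moreover have "t + 2 * pi * real (Suc i) / real k - 2 * pi \<le> s"
    unfolding s_def e[symmetric]
    using i j le[of "real (Suc i) - real k" "real j"]
      le[of "real (Suc i) - real k" "real j - real k"] by (cases "j \<le> i") auto
  moreover have "s \<le> t + 2 * pi * real i / real k"
    unfolding s_def using i j le[of "real j" "real i"] le[of "real j - real k" "real i"]
    by (cases "j \<le> i") auto
  ultimately show "\<exists>q s. 0 \<le> q \<and> q \<le> 1 \<and> a = q *\<^sub>R circ s \<and>
      t + 2 * pi * real (Suc i) / real k - 2 * pi \<le> s \<and> s \<le> t + 2 * pi * real i / real k"
    by (intro exI[of _ 1] exI[of _ s]) auto
qed

lemma circ_mem_gon_Suc:
  assumes "i < k"
  shows "circ (t + 2 * pi * real (Suc i) / real k) \<in> gon k t"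
proof (cases "Suc i < k")
  case True
  then show ?thesis unfolding gon_def by blast
next
  case False
  \<comment> \<open>The last gap ends at the first vertex, one full turn later.\<close>
  then have "Suc i = k" using assms by simp
  then have "circ (t + 2 * pi * real (Suc i) / real k) = circ (t + 2 * pi * real 0 / real k)"
    using assms by simp
  moreover have "0 < k" using assms by simp
  ultimately show ?thesis unfolding gon_def by blast
qed

text \<open>Neighbouring vertices bound a gap of half-width \<open>pi / k < pi / 2\<close>, and the
  hull contains the origin and both ends, so each gap pays exactly its cost.\<close>

lemma radial_gon:
  fixes k :: nat
  assumes k: "k \<ge> 3" and r: "0 \<le> r" "r \<le> 1"
  shows "radial (convex hull gon k t) r = real k * gap_cost r (pi / k)"
proof -
  let ?t = "\<lambda>i. t + 2 * pi * real i / real k" and ?C = "convex hull gon k t"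
  have gp: "gap_partition k ?t (gon k t)" using k by (intro gap_partition_gon) auto
  have b: "0 < pi / k" "pi / k < pi / 2" using k frac_less2[of pi pi 2 "real k"] by auto
  have "radial ?C r = (\<Sum>i<k. integral {?t i..?t (Suc i)} (angular ?C r))"
    using gp unfolding gap_partition_def by (intro radial_partition) auto
  also have "\<dots> = (\<Sum>i<k. gap_cost r (pi / k))"
  proof (rule sum.cong)
    fix i assume "i \<in> {..<k}"
    then have i: "i < k" by simp
    define m where "m = (?t i + ?t (Suc i)) / 2"
    have mid: "x = (x + y) / 2 - (y - x) / 2" "y = (x + y) / 2 + (y - x) / 2" for x y :: real
      by (simp_all add: field_simps)
    have h: "(?t (Suc i) - ?t i) / 2 = pi / k" by (simp add: algebra_simps add_divide_distrib)
    have ti: "?t i = m - pi / k" and tS: "?t (Suc i) = m + pi / k"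
      unfolding m_def h[symmetric] by (rule mid)+
    have "integral {m - pi / k..m + pi / k} (angular ?C r) = gap_cost r (pi / k)"
    proof (rule integral_angular_sector)
      show "0 \<in> ?C" using zero_mem_convex_hull_equidistant k unfolding gon_def by auto
      show "circ (m - pi / k) \<in> ?C"
        unfolding ti[symmetric] using i unfolding gon_def by (intro hull_inc) blast
      show "circ (m + pi / k) \<in> ?C"
        unfolding tS[symmetric] using i by (intro hull_inc circ_mem_gon_Suc)
      fix y assume "y \<in> ?C"
      from gap_partition_halfspace[OF gp i this]
      have "y \<bullet> circ m \<le> max 0 (cos (pi / k))" unfolding h m_def .
      moreover have "0 \<le> cos (pi / k)" using b by (intro cos_ge_zero) auto
      ultimately show "y \<bullet> circ m \<le> cos (pi / k)" by simp
    qed (use b r in auto)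
    then show "integral {?t i..?t (Suc i)} (angular ?C r) = gap_cost r (pi / k)"
      by (simp only: ti tS)
  qed simp
  finally show ?thesis by simp
qed

section \<open>Arbitrary configurations and the equality case\<close>

text \<open>The polar angles, sorted and taken with multiplicity, are the gap ends. Repeated
  directions give gaps of width zero, and the first angle plus a full turn closes the
  circle.\<close>

lemma ex_gap_partition:
  assumes A: "size A = k" "set_mset A \<subseteq> cball 0 1" and k: "0 < k"
  shows "\<exists>t. gap_partition k t (set_mset A)"
proof -
  define \<theta> :: "real^2 \<Rightarrow> real"
    where "\<theta> x = (SOME s. 0 \<le> s \<and> s < 2 * pi \<and> x = norm x *\<^sub>R circ s)" for x
  have "0 \<le> \<theta> x \<and> \<theta> x < 2 * pi \<and> x = norm x *\<^sub>R circ (\<theta> x)" for x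
    unfolding \<theta>_def by (rule someI_ex) (rule polar_form[of x], blast)
  then have \<theta>: "0 \<le> \<theta> x" "\<theta> x < 2 * pi" "norm x *\<^sub>R circ (\<theta> x) = x" for x
    by auto
  define ts where "ts = sorted_list_of_multiset (image_mset \<theta> A)"
  have len: "length ts = k"
    using A(1) size_mset[of ts] by (simp add: ts_def)
  have sorted: "sorted ts" by (simp add: ts_def)
  have set: "set ts = \<theta> ` set_mset A" by (simp add: ts_def)
  have bd: "0 \<le> ts ! i" "ts ! i < 2 * pi" if "i < k" for i
    using nth_mem[of i ts] that len set \<theta> by auto
  have nth_le: "ts ! i \<le> ts ! j" if "i \<le> j" "j < k" for i j
    using sorted_nth_mono[OF sorted] that len by simp
  define t where "t i = (if i < k then ts ! i else ts ! 0 + 2 * pi)" for i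
  have "gap_partition k t (set_mset A)"
    unfolding gap_partition_def
  proof (intro conjI ballI allI impI)
    fix i assume i: "i < k"
    show "t i \<le> t (Suc i)"
      using i bd[OF i] bd[OF k] nth_le[of i "Suc i"] by (auto simp: t_def)
  next
    show "t k = t 0 + 2 * pi" using k by (simp add: t_def)
  next
    fix a i assume a: "a \<in> set_mset A" and i: "i < k"
    then obtain j where j: "j < k" "\<theta> a = ts ! j"
      using set len by (metis image_eqI in_set_conv_nth)
    \<comment> \<open>Angles up to index \<open>i\<close> already lie left of the gap; later ones
      are taken one turn earlier.\<close>
    define s where "s = (if j \<le> i then \<theta> a else \<theta> a - 2 * pi)"
    have "circ s = circ (\<theta> a)" unfolding s_def using circ_periodic[of "\<theta> a - 2 * pi"] by simp
    then have "a = norm a *\<^sub>R circ s" using \<theta>(3)[of a] by simp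
    moreover have "norm a \<le> 1" using a A by auto
    moreover have "t (Suc i) - 2 * pi \<le> s"
      using j i bd[OF j(1)] bd[of "Suc i"] nth_le[of 0 j] nth_le[of "Suc i" j]
      by (auto simp: s_def t_def)
    moreover have "s \<le> t i"
      using j i bd[OF j(1)] bd[OF i] nth_le[of j i] by (auto simp: s_def t_def)
    ultimately show "\<exists>q s. 0 \<le> q \<and> q \<le> 1 \<and> a = q *\<^sub>R circ s \<and> t (Suc i) - 2 * pi \<le> s \<and> s \<le> t i"
      by (intro exI[of _ "norm a"] exI[of _ s]) auto
  qed
  then show ?thesis by blast
qed

lemma card_gon: "0 < k \<Longrightarrow> card (gon k t) = k"
  unfolding gon_def by (simp add: card_image inj_on_circ_equidistant)

lemma finite_gon [simp]: "finite (gon k t)"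
  by (simp add: gon_def)

lemma gon_subset_sphere: "gon k t \<subseteq> sphere 0 1"
  by (auto simp: gon_def)

text \<open>Equality on the unit circle puts \<open>k\<close> equally spaced unit vectors into the
  hull; being extreme in the disk, they belong to \<open>A\<close>. As \<open>A\<close> has
  \<open>k\<close> members counted with multiplicity, it contains each of them once and nothing
  else.\<close>

lemma optimal_imp_gon:
  fixes k :: nat
  assumes k: "k \<ge> 3" and A: "size A = k" "set_mset A \<subseteq> cball 0 1"
    and le: "radial (convex hull set_mset A) 1 \<le> real k * gap_cost 1 (pi / k)"
  shows "\<exists>t. A = mset_set (gon k t)"
proof -
  obtain t where gp: "gap_partition k t (set_mset A)"
    using ex_gap_partition[OF A] k by auto
  have ne: "set_mset A \<noteq> {}" using A k by auto
  have D: "t (Suc i) = t i + 2 * pi / k \<and> circ (t i) \<in> convex hull set_mset A" if "i < k" for i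
    by (rule radial_le_eqD[OF k gp ne _ _ _ _ _ that]) (use le that in auto)
  have t: "t i = t 0 + 2 * pi * real i / real k" if "i < k" for i
    using that
  proof (induction i)
    case (Suc i)
    then show ?case using D[of i] by (simp add: algebra_simps add_divide_distrib)
  qed simp
  have "gon k (t 0) \<subseteq> set_mset A"
  proof
    fix x assume "x \<in> gon k (t 0)"
    then obtain i where i: "i < k" "x = circ (t 0 + 2 * pi * real i / real k)"
      unfolding gon_def by auto
    have x: "x = circ (t i)" using i(2) t[OF i(1)] by metis
    show "x \<in> set_mset A"
    proof (rule mem_of_mem_convex_hull_cball)
      show "x \<in> convex hull set_mset A" using D[OF i(1)] unfolding x by blast
      show "dist 0 x = 1" by (simp add: x)
    qed (rule A(2))
  qed
  then have "mset_set (gon k (t 0)) \<subseteq># A"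
    by (metis finite_gon finite_set_mset mset_set_set_mset_msubset msubset_mset_set_iff subset_mset.order_trans)
  moreover have "size (mset_set (gon k (t 0))) = size A" using k A by (simp add: card_gon)
  ultimately have "mset_set (gon k (t 0)) = A"
    using mset_subset_size nless_le subset_mset.nless_le by (metis order_less_irrefl)
  then show ?thesis by blast
qed

text \<open>The points lie on the sphere of radius \<open>r\<close> around \<open>c\<close> and
  their hull stays in that ball, so each of them is extreme.\<close>

lemma vertices_gon: "vertices (convex hull ((\<lambda>x. c + r *\<^sub>R x) ` gon k t)) = (\<lambda>x. c + r *\<^sub>R x) ` gon k t"
  if "0 < r"
proof -
  let ?V = "(\<lambda>x. c + r *\<^sub>R x) ` gon k t"
  have sub: "convex hull ?V \<subseteq> cball c r"
    using gon_subset_sphere[of k t] that by (intro hull_minimal) (auto simp: dist_norm)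
  have "x extreme_point_of (convex hull ?V)" if x: "x \<in> ?V" for x
  proof -
    have "dist c x = r" using x gon_subset_sphere[of k t] \<open>0 < r\<close> by (auto simp: dist_norm)
    then have "x extreme_point_of cball c r" by (rule extreme_point_of_cball)
    then show ?thesis using sub hull_inc[OF x] unfolding extreme_point_of_def by blast
  qed
  then show ?thesis unfolding vertices_def using extreme_point_of_convex_hull by blast
qed

text \<open>\<open>regular_polygon\<close> allows any centre and radius; this removes both.
  Expanding the squared norm of a vertex shows that all vertex directions have the same inner
  product with \<open>c\<close>. If \<open>c\<close> is nonzero, three consecutive angles at steps
  \<open>d\<close> with \<open>0 < d < pi\<close> would share one cosine, which is
  impossible.\<close>

lemma circumscribed_gon_unique:
  fixes k :: nat
  assumes k: "k \<ge> 3" and r: "0 < r" and V: "(\<lambda>x. c + r *\<^sub>R x) ` gon k t \<subseteq> sphere 0 1"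
  shows "c = 0" "r = 1"
proof -
  define d where "d = 2 * pi / k"
  have d: "0 < d" "d < pi" using k by (auto simp: d_def field_simps)
  obtain s where s: "c = norm c *\<^sub>R circ s" by (rule polar_form)
  have u: "norm (c + r *\<^sub>R circ (t + real j * d)) = 1" if "j < k" for j
  proof -
    have "circ (t + 2 * pi * real j / real k) \<in> gon k t"
      using that unfolding gon_def by blast
    then have "c + r *\<^sub>R circ (t + 2 * pi * real j / real k) \<in> sphere 0 1" using V by blast
    then show ?thesis by (simp add: d_def mult.commute)
  qed
  have n: "(norm c)\<^sup>2 + 2 * r * norm c * cos (t + real j * d - s) + r\<^sup>2 = 1" if "j < k" for j
  proof -
    have "(norm (c + r *\<^sub>R circ (t + real j * d)))\<^sup>2
        = (norm c)\<^sup>2 + 2 * r * (circ (t + real j * d) \<bullet> c) + r\<^sup>2 * (circ (t + real j * d) \<bullet> circ (t + real j * d))"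
      unfolding power2_norm_eq_inner
      by (simp add: inner_add_left inner_add_right inner_commute power2_eq_square)
    moreover have "circ (t + real j * d) \<bullet> c = norm c * cos (t + real j * d - s)"
      by (subst s) (simp add: inner_circ)
    ultimately show ?thesis using u[OF that] by (simp add: inner_circ)
  qed
  show c: "c = 0"
  proof (rule ccontr)
    assume "c \<noteq> 0"
    then have nz: "2 * r * norm c \<noteq> 0" using r by simp
    define x where "x = t + d - s"
    have xs: "x - d = t + real 0 * d - s" "x = t + real 1 * d - s" "x + d = t + real 2 * d - s"
      by (simp_all add: x_def)
    have "2 * r * norm c * cos (x - d) = 2 * r * norm c * cos x"
      using n[of 0, folded xs(1)] n[of 1, folded xs(2)] k by linarith
    moreover have "2 * r * norm c * cos (x + d) = 2 * r * norm c * cos x"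
      using n[of 2, folded xs(3)] n[of 1, folded xs(2)] k by linarith
    ultimately have e: "cos (x - d) = cos x" "cos (x + d) = cos x" using nz by auto
    \<comment> \<open>Sum and difference of the addition formulas for \<open>x - d\<close> and
      \<open>x + d\<close>.\<close>
    then have "cos x * (cos d - 1) = 0" "sin x * sin d = 0"
      by (auto simp: cos_add cos_diff algebra_simps)
    moreover have "cos d < 1" using cos_monotone_0_pi[of 0 d] d by simp
    moreover have "sin d > 0" using d by (rule sin_gt_zero)
    ultimately have "cos x = 0" "sin x = 0" by auto
    then show False using sin_cos_squared_add[of x] by simp
  qed
  show "r = 1" using u[of 0] k r c by simp
qed

section \<open>Integration over the disk\<close>

definition rotmat :: "real \<Rightarrow> real^2^2" where
  "rotmat a = vector [vector [cos a, - sin a], vector [sin a, cos a]]"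

lemma rotmat_mult: "rotmat a *v x = vector [cos a * x $ 1 - sin a * x $ 2, sin a * x $ 1 + cos a * x $ 2]"
  by (simp add: rotmat_def vec_eq_iff forall_2 matrix_vector_mult_def sum_2)

lemma rotmat_circ: "rotmat a *v circ s = circ (s + a)"
  by (simp add: rotmat_mult vec_eq_iff forall_2 cos_add sin_add)

lemma rotmat_scaleR_circ: "rotmat a *v (r *\<^sub>R circ s) = r *\<^sub>R circ (s + a)"
  by (simp add: matrix_vector_mult_scaleR rotmat_circ)

lemma rotation_matrix_rotmat: "rotation_matrix (rotmat a)"
proof -
  have sq: "cos a * cos a + sin a * sin a = 1" "sin a * sin a + cos a * cos a = 1"
    using sin_cos_squared_add2[of a] sin_cos_squared_add[of a] by (simp_all add: power2_eq_square)
  have "orthogonal_matrix (rotmat a)"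
    unfolding orthogonal_matrix
    by (simp add: rotmat_def vec_eq_iff forall_2 matrix_matrix_mult_def sum_2 transpose_def mat_def sq)
  moreover have "det (rotmat a) = 1"
    by (simp add: det_2 rotmat_def sq)
  ultimately show ?thesis by (simp add: rotation_matrix_def)
qed

lemma orthogonal_transformation_rotmat: "orthogonal_transformation ((*v) (rotmat a))"
  using rotation_matrix_rotmat[of a]
  by (simp add: rotation_matrix_def orthogonal_transformation_matrix)

lemma norm_rotmat [simp]: "norm (rotmat a *v x) = norm x"
  using orthogonal_transformation_rotmat by (rule orthogonal_transformation_norm)

lemma rotmat_inverse: "rotmat (- a) *v (rotmat a *v x) = x"
  by (rule polar_form[of x]) (metis rotmat_scaleR_circ add.assoc add.right_inverse add.right_neutral)

text \<open>Joint continuity in angle and point supplies the joint measurability for Fubini.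
  Rotation by \<open>a\<close> is \<open>cos a\<close> times the identity plus \<open>sin a\<close>
  times the quarter turn \<open>J\<close>.\<close>

lemma continuous_on_rotmat: "continuous_on UNIV (\<lambda>(a, x). rotmat a *v x)"
proof -
  define J where "J = (*v) (rotmat (pi / 2))"
  have "(\<lambda>(a, x). rotmat a *v x) = (\<lambda>p. cos (fst p) *\<^sub>R snd p + sin (fst p) *\<^sub>R J (snd p))"
    by (auto simp: J_def rotmat_mult vec_eq_iff forall_2)
  moreover have "continuous_on UNIV (\<lambda>p :: real \<times> (real^2). J (snd p))"
    unfolding J_def
    by (intro matrix_vector_mult_linear_continuous_on[THEN continuous_on_compose2[of UNIV]]
        continuous_intros) auto
  then have "continuous_on UNIV (\<lambda>p. cos (fst p) *\<^sub>R snd p + sin (fst p) *\<^sub>R J (snd p))"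
    by (intro continuous_intros)
  ultimately show ?thesis by argo
qed

section \<open>The uniform measure on the disk\<close>

lemma emeasure_unit_disk: "emeasure lborel unit_disk = ennreal pi"
  unfolding unit_disk_def by (subst emeasure_cball) (auto simp: unit_ball_vol_2)

lemma sets_unit_disk [measurable, simp]: "unit_disk \<in> sets borel"
  by (simp add: unit_disk_def)

lemma sets_mu_disk [measurable_cong, simp]: "sets mu_disk = sets borel"
  by (simp add: mu_disk_def)

lemma space_mu_disk [simp]: "space mu_disk = UNIV"
  by (simp add: mu_disk_def)

lemma emeasure_mu_disk: "A \<in> sets borel \<Longrightarrow> emeasure mu_disk A = emeasure lborel (unit_disk \<inter> A) / ennreal pi"
  unfolding mu_disk_def by (subst emeasure_uniform_measure) (auto simp: emeasure_unit_disk)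

lemma AE_mu_disk: "AE x in mu_disk. x \<in> unit_disk"
  unfolding mu_disk_def by (intro AE_uniform_measureI) auto

lemma finite_measure_mu_disk: "finite_measure mu_disk"
proof
  have "emeasure mu_disk UNIV = ennreal pi / ennreal pi"
    by (simp add: emeasure_mu_disk emeasure_unit_disk)
  also have "\<dots> = 1" by (simp add: divide_ennreal)
  finally show "emeasure mu_disk (space mu_disk) \<noteq> \<infinity>" by simp
qed

lemma integral_uniform_measure:
  fixes f :: "'a \<Rightarrow> real"
  assumes f: "f \<in> borel_measurable M" and A: "A \<in> sets M" "emeasure M A = ennreal c" and c: "0 < c"
  shows "integral\<^sup>L (uniform_measure M A) f = (LINT x:A|M. f x) / c"
proof -
  have "uniform_measure M A = density M (\<lambda>x. ennreal (indicator A x / c))"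
    unfolding uniform_measure_def A(2) using c
    by (intro arg_cong[of _ _ "density M"] ext)
       (auto simp: divide_ennreal simp flip: ennreal_indicator)
  also have "integral\<^sup>L \<dots> f = (LINT x|M. indicator A x / c * f x)"
    using f A c by (subst integral_real_density) auto
  also have "\<dots> = (LINT x:A|M. f x) / c"
    by (simp add: set_lebesgue_integral_def mult.commute flip: integral_divide_zero)
  finally show ?thesis .
qed

text \<open>The rotation is orthogonal and maps the preimage of \<open>A\<close> within the disk
  onto the part of \<open>A\<close> within the disk, so both have the same area.\<close>

lemma distr_mu_disk_rotmat: "distr mu_disk borel ((*v) (rotmat a)) = mu_disk"
proof (rule measure_eqI)
  fix A :: "(real^2) set"
  assume "A \<in> sets (distr mu_disk borel ((*v) (rotmat a)))"
  then have A: "A \<in> sets borel" by simp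
  let ?T = "(*v) (rotmat a)"
  have meas: "?T \<in> borel_measurable borel"
    by (intro borel_measurable_continuous_onI matrix_vector_mult_linear_continuous_on)
  then have TA: "?T -` A \<in> sets borel" using measurable_sets_borel[OF meas A] by simp
  let ?S = "unit_disk \<inter> ?T -` A"
  have lm: "unit_disk \<inter> B \<in> lmeasurable" if "B \<in> sets borel" for B
    using that by (intro bounded_set_imp_lmeasurable) (auto simp: unit_disk_def intro: bounded_Int)
  have em: "emeasure lborel (unit_disk \<inter> B) = ennreal (measure lebesgue (unit_disk \<inter> B))"
    if "B \<in> sets borel" for B
    using emeasure_eq_measure2[OF lm[OF that]] that by simp
  have "?T ` ?S = unit_disk \<inter> A"
  proof (intro equalityI subsetI)
    fix y assume y: "y \<in> unit_disk \<inter> A"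
    have "y = ?T (rotmat (- a) *v y)" using rotmat_inverse[of "- a" y] by simp
    moreover have "rotmat (- a) *v y \<in> unit_disk" using y by (simp add: unit_disk_def)
    ultimately show "y \<in> ?T ` ?S" using y by (intro image_eqI[of _ _ "rotmat (- a) *v y"]) auto
  qed (auto simp: unit_disk_def)
  then have "measure lebesgue (unit_disk \<inter> A) = measure lebesgue ?S"
    using measure_orthogonal_image[OF orthogonal_transformation_rotmat lm[OF TA], of a] by simp
  then show "emeasure (distr mu_disk borel ?T) A = emeasure mu_disk A"
    using A TA meas by (subst emeasure_distr) (auto simp: emeasure_mu_disk em measurable_def)
qed simp

lemma set_integrable_bounded_Icc:
  fixes f :: "real \<Rightarrow> real"
  assumes "f \<in> borel_measurable borel" "\<And>x. \<bar>f x\<bar> \<le> B"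
  shows "set_integrable lborel {a..b} f"
  unfolding set_integrable_def
  using assms by (intro integrableI_bounded_set_indicator[of _ _ _ B]) (auto simp: emeasure_lborel_Icc_eq)

text \<open>Does the work of polar coordinates: invariance lets the integral be averaged over all
  rotations, and after Fubini the mean over the angle at \<open>x\<close> depends on
  \<open>norm x\<close> only. Boundedness gives integrability on the finite product measure.\<close>

lemma integral_mu_disk_angular:
  fixes f :: "real^2 \<Rightarrow> real"
  assumes f: "f \<in> borel_measurable borel" and B: "\<And>x. \<bar>f x\<bar> \<le> B"
  shows "(LINT x|mu_disk. f x) = (LINT x|mu_disk. integral {0..2 * pi} (\<lambda>s. f (norm x *\<^sub>R circ s)) / (2 * pi))"
proof -
  define N where "N = uniform_measure lborel {0..2 * pi}"
  have em: "emeasure lborel {0..2 * pi} = ennreal (2 * pi)" by simp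
  have setsN [measurable_cong]: "sets N = sets borel" by (simp add: N_def)
  have emN: "emeasure N UNIV = 1"
    unfolding N_def by (subst emeasure_uniform_measure) (auto simp: em divide_ennreal simp del: emeasure_lborel_Icc_eq)
  interpret N: finite_measure N
    by standard (simp add: emN N_def[THEN arg_cong[of _ _ space]])
  interpret mu: finite_measure mu_disk by (rule finite_measure_mu_disk)
  interpret P: pair_sigma_finite N mu_disk ..
  interpret PP: finite_measure "N \<Otimes>\<^sub>M mu_disk"
    by (intro finite_measure_pair_measure N.finite_measure_axioms mu.finite_measure_axioms)
  have rot: "(\<lambda>(a, x). rotmat a *v x) \<in> borel_measurable (borel \<Otimes>\<^sub>M borel)"
    unfolding borel_prod by (intro borel_measurable_continuous_onI continuous_on_rotmat)
  have meas: "(\<lambda>(a, x). f (rotmat a *v x)) \<in> borel_measurable (N \<Otimes>\<^sub>M mu_disk)"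
    using measurable_compose[OF rot f] by (simp add: case_prod_unfold cong: measurable_cong_sets)
  have int: "integrable (N \<Otimes>\<^sub>M mu_disk) (\<lambda>(a, x). f (rotmat a *v x))"
    by (rule PP.integrable_const_bound[of _ B]) (use B meas in auto)
  have inner: "(LINT a|N. f (rotmat a *v x)) = integral {0..2 * pi} (\<lambda>s. f (norm x *\<^sub>R circ s)) / (2 * pi)" for x
  proof -
    obtain s where s: "x = norm x *\<^sub>R circ s" by (rule polar_form)
    define h where "h u = f (norm x *\<^sub>R circ u)" for u
    have h_meas: "h \<in> borel_measurable borel"
      unfolding h_def
      by (intro measurable_compose[OF _ f] borel_measurable_continuous_onI continuous_intros)
    have h_int: "h integrable_on {u..v}" for u v
      using set_borel_integral_eq_integral(1)[OF set_integrable_bounded_Icc[OF h_meas, of B]] B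
      by (simp add: h_def)
    have hs_meas: "(\<lambda>a. h (s + a)) \<in> borel_measurable borel"
      using h_meas by measurable
    have eq: "f (rotmat a *v x) = h (s + a)" for a
      by (subst s) (simp only: rotmat_scaleR_circ h_def)
    have "(LINT a|N. f (rotmat a *v x)) = (LINT a:{0..2 * pi}|lborel. h (s + a)) / (2 * pi)"
      unfolding N_def eq using hs_meas by (intro integral_uniform_measure em) auto
    also have "(LINT a:{0..2 * pi}|lborel. h (s + a)) = integral {0..2 * pi} (\<lambda>a. h (s + a))"
      by (intro set_borel_integral_eq_integral(2) set_integrable_bounded_Icc[OF hs_meas, of B])
        (simp add: h_def B)
    \<comment> \<open>The direction \<open>s\<close> of \<open>x\<close> only shifts the window of a
      function with period \<open>2 * pi\<close>.\<close>
    also have "\<dots> = integral {s..s + 2 * pi} h"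
      using integral_shift_real[of 0 s "2 * pi" h] by (simp add: add.commute)
    also have "\<dots> = integral {0..2 * pi} h"
      by (rule integral_periodic) (simp_all add: h_int, simp add: h_def)
    finally show ?thesis by (simp add: h_def[abs_def])
  qed
  have "(LINT x|mu_disk. f x) = (LINT x|mu_disk. f (rotmat a *v x))" for a
    by (subst distr_mu_disk_rotmat[of a, symmetric], rule integral_distr)
      (auto intro!: f borel_measurable_continuous_onI matrix_vector_mult_linear_continuous_on
        simp: measurable_cong_sets[OF sets_mu_disk refl])
  then have "(LINT a|N. LINT x|mu_disk. f (rotmat a *v x)) = (LINT a|N. (LINT x|mu_disk. f x))"
    by simp
  also have "\<dots> = (LINT x|mu_disk. f x)"
    using emN by (simp add: measure_def N_def)
  finally have "(LINT x|mu_disk. f x) = (LINT a|N. LINT x|mu_disk. f (rotmat a *v x))" ..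
  also have "\<dots> = (LINT x|mu_disk. LINT a|N. f (rotmat a *v x))"
    using P.Fubini_integral[OF int] by simp
  finally show ?thesis by (simp only: inner)
qed

lemma integral_mu_disk_indicator:
  fixes h :: "real^2 \<Rightarrow> real"
  assumes h: "h \<in> borel_measurable borel"
  shows "(LINT x|mu_disk. indicator unit_disk x * h x) = (LINT x|mu_disk. h x)"
proof (rule integral_cong_AE)
  have "(\<lambda>x. indicator unit_disk x * h x) \<in> borel_measurable borel"
    using h by (intro borel_measurable_times) auto
  then show "(\<lambda>x. indicator unit_disk x * h x) \<in> borel_measurable mu_disk"
    by (simp cong: measurable_cong_sets)
  show "h \<in> borel_measurable mu_disk"
    using h by (simp cong: measurable_cong_sets)
  show "AE x in mu_disk. indicator unit_disk x * h x = h x"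
    using AE_mu_disk by eventually_elim simp
qed

lemma continuous_on_radial [continuous_intros]:
  fixes f :: "'a::t2_space \<Rightarrow> real"
  assumes "continuous_on S f"
  shows "continuous_on S (\<lambda>x. radial K (f x))"
proof -
  have "continuous_on UNIV (radial K)"
    unfolding radial_def angular_def interval_cbox
    by (intro integral_continuous_on_param) (auto simp: case_prod_unfold intro!: continuous_intros)
  then show ?thesis by (rule continuous_on_compose2) (use assms in auto)
qed

text \<open>The squared distance is unbounded on the plane, so it is cut off to the disk, where it
  is at most 4. The cut-off depends on the norm only and passes through the angular mean.\<close>

lemma integral_mu_disk_infdist:
  assumes K: "K \<noteq> {}" "K \<subseteq> unit_disk"
  shows "(LINT x|mu_disk. (infdist x K)\<^sup>2) = (LINT x|mu_disk. radial K (norm x) / (2 * pi))"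
proof -
  let ?f = "\<lambda>x. indicator unit_disk x * (infdist x K)\<^sup>2"
  have meas: "(\<lambda>x. (infdist x K)\<^sup>2) \<in> borel_measurable borel"
    by (intro borel_measurable_continuous_onI continuous_intros)
  then have f: "?f \<in> borel_measurable borel"
    by measurable
  have rad: "(\<lambda>x. radial K (norm x) / (2 * pi)) \<in> borel_measurable borel"
    by (intro borel_measurable_continuous_onI continuous_intros) auto
  have B: "\<bar>?f x\<bar> \<le> 2\<^sup>2" for x
  proof (cases "x \<in> unit_disk")
    case True
    obtain y where y: "y \<in> K" using K by auto
    have "infdist x K \<le> dist x y" using y by (rule infdist_le)
    also have "\<dots> \<le> 2" using True y K norm_triangle_ineq4[of x y] by (auto simp: unit_disk_def dist_norm)
    finally have "(infdist x K)\<^sup>2 \<le> 2\<^sup>2" by (intro power_mono infdist_nonneg)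
    then show ?thesis using True by simp
  qed simp
  have "(LINT x|mu_disk. (infdist x K)\<^sup>2) = (LINT x|mu_disk. ?f x)"
    by (rule integral_mu_disk_indicator[OF meas, symmetric])
  also have "\<dots> = (LINT x|mu_disk. integral {0..2 * pi} (\<lambda>s. ?f (norm x *\<^sub>R circ s)) / (2 * pi))"
    by (rule integral_mu_disk_angular[OF f B])
  also have "\<dots> = (LINT x|mu_disk. indicator unit_disk x * (radial K (norm x) / (2 * pi)))"
    by (intro Bochner_Integration.integral_cong refl)
      (auto simp: radial_def angular_def[abs_def] unit_disk_def indicator_def)
  also have "\<dots> = (LINT x|mu_disk. radial K (norm x) / (2 * pi))"
    by (rule integral_mu_disk_indicator[OF rad])
  finally show ?thesis .
qed

section \<open>Support, feasibility and the objective\<close>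

lemma msupport_mu_disk: "msupport mu_disk = unit_disk"
proof (intro equalityI subsetI)
  fix x assume x: "x \<in> msupport mu_disk"
  show "x \<in> unit_disk"
  proof (rule ccontr)
    assume "x \<notin> unit_disk"
    moreover have op: "open (- unit_disk)" by (auto simp: unit_disk_def open_Compl)
    ultimately have "0 < emeasure mu_disk (- unit_disk)" using x by (auto simp: msupport_def)
    moreover have "emeasure mu_disk (- unit_disk) = 0" using op by (simp add: emeasure_mu_disk)
    ultimately show False by simp
  qed
next
  fix x assume x: "x \<in> unit_disk"
  show "x \<in> msupport mu_disk"
    unfolding msupport_def
  proof (intro CollectI allI impI, elim conjE)
    fix U assume U: "open U" "x \<in> U"
    \<comment> \<open>A neighbourhood of a boundary point sticks out of the disk; a small ball
      inside the open disk supplies the mass.\<close>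
    have "x \<in> closure (ball 0 1)" using x by (simp add: unit_disk_def)
    then have "U \<inter> ball 0 1 \<noteq> {}" using U open_Int_closure_eq_empty[OF U(1)] by blast
    then obtain y where y: "y \<in> U \<inter> ball 0 1" by blast
    obtain e where e: "0 < e" "ball y e \<subseteq> U \<inter> ball 0 1"
      using openE[OF open_Int[OF U(1) open_ball] y] by blast
    have "0 < emeasure lborel (ball y e)"
      using e(1) by (subst emeasure_ball) (auto simp: unit_ball_vol_2)
    also have "\<dots> \<le> emeasure lborel (unit_disk \<inter> U)"
      using e U by (intro emeasure_mono) (auto simp: unit_disk_def)
    finally show "0 < emeasure mu_disk U"
      using U by (simp add: emeasure_mu_disk ennreal_zero_less_divide)
  qed
qed

lemma feasible_mu_disk_iff: "feasible mu_disk k A \<longleftrightarrow> size A = k \<and> set_mset A \<subseteq> cball 0 1"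
  unfolding feasible_def msupport_mu_disk by (simp add: unit_disk_def convex_cball hull_same)

lemma integrable_mu_disk:
  fixes f :: "real^2 \<Rightarrow> real"
  assumes "continuous_on UNIV f"
  shows "integrable mu_disk f"
proof -
  interpret finite_measure mu_disk by (rule finite_measure_mu_disk)
  have "compact (f ` unit_disk)"
    using assms by (intro compact_continuous_image) (auto simp: unit_disk_def intro: continuous_on_subset)
  then obtain B where "\<And>x. x \<in> unit_disk \<Longrightarrow> norm (f x) \<le> B"
    using compact_imp_bounded bounded_iff by (metis image_eqI)
  then have "AE x in mu_disk. norm (f x) \<le> B" using AE_mu_disk by (auto elim: eventually_mono)
  then show ?thesis
    using borel_measurable_continuous_onI[OF assms]
    by (intro integrable_const_bound) (auto cong: measurable_cong_sets)
qed

lemma F_obj_mu_disk: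
  assumes "A \<noteq> {#}" "set_mset A \<subseteq> cball 0 1"
  shows "(F_obj mu_disk A)\<^sup>2 = (LINT x|mu_disk. radial (convex hull set_mset A) (norm x)) / (2 * pi)"
proof -
  have "convex hull set_mset A \<subseteq> unit_disk"
    unfolding unit_disk_def using assms by (intro hull_minimal) auto
  moreover have "0 \<le> (LINT x|mu_disk. (infdist x (convex hull set_mset A))\<^sup>2)"
    by (rule Bochner_Integration.integral_nonneg) simp
  ultimately show ?thesis
    using integral_mu_disk_infdist[of "convex hull set_mset A"] assms by (simp add: F_obj_def)
qed

text \<open>Strict inequality on the unit circle alone suffices: by continuity the difference is
  positive on an open set around the support point \<open>circ 0\<close>, and such a set has
  positive mass.\<close>

lemma integral_radial_less:
  assumes ge: "\<And>r. 0 \<le> r \<Longrightarrow> r \<le> 1 \<Longrightarrow> radial L r \<le> radial K r" and "radial L 1 < radial K 1"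
  shows "(LINT x|mu_disk. radial L (norm x)) < (LINT x|mu_disk. radial K (norm x))"
proof -
  define h where "h x = radial K (norm x) - radial L (norm x)" for x :: "real^2"
  have cont: "continuous_on UNIV h" unfolding h_def by (intro continuous_intros)
  have nonneg: "AE x in mu_disk. 0 \<le> h x"
    using AE_mu_disk by eventually_elim (simp add: h_def unit_disk_def ge)
  have "\<not> (AE x in mu_disk. h x = 0)"
  proof
    assume AE: "AE x in mu_disk. h x = 0"
    let ?U = "{x. 0 < h x}"
    have op: "open ?U" using open_Collect_less[of "\<lambda>_. 0" h] cont by simp
    have "emeasure mu_disk ?U = emeasure mu_disk {}"
      using AE op by (intro emeasure_eq_AE) (auto elim: eventually_mono)
    moreover have "circ 0 \<in> msupport mu_disk" "circ 0 \<in> ?U"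
      using assms(2) by (auto simp: msupport_mu_disk unit_disk_def h_def)
    ultimately show False using op unfolding msupport_def by fastforce
  qed
  then have "(LINT x|mu_disk. h x) \<noteq> 0"
    using integral_nonneg_eq_0_iff_AE[OF integrable_mu_disk[OF cont] nonneg] by simp
  moreover have "0 \<le> (LINT x|mu_disk. h x)" using nonneg by (rule integral_nonneg_AE)
  moreover have "(LINT x|mu_disk. h x)
      = (LINT x|mu_disk. radial K (norm x)) - (LINT x|mu_disk. radial L (norm x))"
    unfolding h_def
    by (intro Bochner_Integration.integral_diff integrable_mu_disk continuous_intros)
  ultimately show ?thesis by simp
qed

lemma integral_radial_mono:
  assumes ge: "\<And>r. 0 \<le> r \<Longrightarrow> r \<le> 1 \<Longrightarrow> radial L r \<le> radial K r"
  shows "(LINT x|mu_disk. radial L (norm x)) \<le> (LINT x|mu_disk. radial K (norm x))"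
  using AE_mu_disk
  by (intro integral_mono_AE integrable_mu_disk continuous_intros)
    (auto simp: unit_disk_def ge elim: eventually_mono)

text \<open>The common squared objective value of the inscribed regular polygons; the phase
  \<open>0\<close> is an arbitrary representative.\<close>

definition gon_obj :: "nat \<Rightarrow> real" where
  "gon_obj k = (LINT x|mu_disk. radial (convex hull gon k 0) (norm x)) / (2 * pi)"

lemma integral_radial_gon:
  fixes k :: nat
  assumes k: "k \<ge> 3"
  shows "(LINT x|mu_disk. radial (convex hull gon k t) (norm x)) / (2 * pi) = gon_obj k"
proof -
  have "(LINT x|mu_disk. radial (convex hull gon k t) (norm x))
      = (LINT x|mu_disk. radial (convex hull gon k 0) (norm x))"
    by (intro antisym integral_radial_mono) (simp_all add: radial_gon[OF k])
  then show ?thesis by (simp add: gon_obj_def)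
qed

lemma F_obj_gon:
  fixes k :: nat
  assumes k: "k \<ge> 3"
  shows "(F_obj mu_disk (mset_set (gon k t)))\<^sup>2 = gon_obj k"
proof -
  have "gon k t \<noteq> {}" using k card_gon[of k t] by auto
  then show ?thesis
    using gon_subset_sphere[of k t] integral_radial_gon[OF k, of t]
    by (subst F_obj_mu_disk) (auto simp: mset_set_empty_iff)
qed

lemma feasible_gon:
  fixes k :: nat
  assumes "k \<ge> 3"
  shows "feasible mu_disk k (mset_set (gon k t))"
  using assms gon_subset_sphere[of k t] by (auto simp: feasible_mu_disk_iff card_gon)

lemma F_obj_nonneg: "0 \<le> F_obj M A"
  unfolding F_obj_def by (simp add: Bochner_Integration.integral_nonneg)

text \<open>The bound on each circle integrates over the disk. If the integrals agree, the bound
  cannot be strict on the unit circle, and equality there determines the configuration.\<close>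

lemma
  fixes k :: nat
  assumes k: "k \<ge> 3" and A: "feasible mu_disk k A"
  shows F_obj_ge: "gon_obj k \<le> (F_obj mu_disk A)\<^sup>2"
    and F_obj_le_imp_gon: "(F_obj mu_disk A)\<^sup>2 \<le> gon_obj k \<Longrightarrow> \<exists>t. A = mset_set (gon k t)"
proof -
  let ?K = "convex hull set_mset A" and ?L = "convex hull gon k 0"
  have A': "size A = k" "set_mset A \<subseteq> cball 0 1" using A by (auto simp: feasible_mu_disk_iff)
  then have ne: "A \<noteq> {#}" using k by auto
  obtain t where gp: "gap_partition k t (set_mset A)" using ex_gap_partition[OF A'] k by auto
  have ge: "radial ?L r \<le> radial ?K r" if "0 \<le> r" "r \<le> 1" for r
    unfolding radial_gon[OF k that] using radial_ge[OF k gp] ne that by simp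
  show "gon_obj k \<le> (F_obj mu_disk A)\<^sup>2"
    unfolding F_obj_mu_disk[OF ne A'(2)] gon_obj_def
    by (intro divide_right_mono integral_radial_mono ge) auto
  assume le: "(F_obj mu_disk A)\<^sup>2 \<le> gon_obj k"
  have "\<not> radial ?L 1 < radial ?K 1"
  proof
    assume "radial ?L 1 < radial ?K 1"
    from integral_radial_less[OF ge this] le show False
      unfolding F_obj_mu_disk[OF ne A'(2)] gon_obj_def by (simp add: divide_le_cancel)
  qed
  then show "\<exists>t. A = mset_set (gon k t)"
    using radial_gon[OF k, of 1 0] by (intro optimal_imp_gon[OF k A']) auto
qed

lemma is_minimizer_iff_gon:
  fixes k :: nat
  assumes k: "k \<ge> 3"
  shows "is_minimizer mu_disk k A \<longleftrightarrow> (\<exists>t. A = mset_set (gon k t))"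
proof
  assume "is_minimizer mu_disk k A"
  then have A: "feasible mu_disk k A" and min: "\<not> F_obj mu_disk (mset_set (gon k 0)) < F_obj mu_disk A"
    using feasible_gon[OF k] by (auto simp: is_minimizer_def is_arg_min_def)
  then have "(F_obj mu_disk A)\<^sup>2 \<le> (F_obj mu_disk (mset_set (gon k 0)))\<^sup>2"
    by (intro power_mono F_obj_nonneg) auto
  then show "\<exists>t. A = mset_set (gon k t)"
    using F_obj_le_imp_gon[OF k A] F_obj_gon[OF k] by simp
next
  assume "\<exists>t. A = mset_set (gon k t)"
  then obtain t where t: "A = mset_set (gon k t)" ..
  have "\<not> F_obj mu_disk B < F_obj mu_disk A" if "feasible mu_disk k B" for B
  proof
    assume "F_obj mu_disk B < F_obj mu_disk A"
    then have "(F_obj mu_disk B)\<^sup>2 < (F_obj mu_disk A)\<^sup>2"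
      by (intro power_strict_mono F_obj_nonneg) auto
    then show False using F_obj_ge[OF k that] F_obj_gon[OF k] t by simp
  qed
  then show "is_minimizer mu_disk k A"
    using feasible_gon[OF k] t by (auto simp: is_minimizer_def is_arg_min_def)
qed

section \<open>The sector integral\<close>

lemma mem_sector_iff:
  assumes "0 < r" "r \<le> 1" "0 \<le> s" "s < 2 * pi" "a < 2 * pi"
  shows "r *\<^sub>R circ s \<in> sector a \<longleftrightarrow> s \<le> a"
proof
  assume "r *\<^sub>R circ s \<in> sector a"
  then obtain q t where q: "r *\<^sub>R circ s = q *\<^sub>R circ t" "0 \<le> q" "0 \<le> t" "t \<le> a"
    unfolding sector_def by auto
  have "r = q" using arg_cong[OF q(1), of norm] q(2) assms(1) by simp
  then have "circ s = circ t" using q(1) assms(1) by simp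
  \<comment> \<open>If \<open>s > a\<close>, then \<open>s - t\<close> lies strictly between
    \<open>0\<close> and \<open>2 * pi\<close>, and the two directions would differ.\<close>
  then show "s \<le> a"
    using circ_add_neq[of "s - t" t] assms q by force
next
  assume "s \<le> a"
  then show "r *\<^sub>R circ s \<in> sector a"
    unfolding sector_def using assms less_imp_le[OF assms(1)] by blast
qed

lemma compact_sector: "compact (sector a)"
proof -
  have "sector a = (\<lambda>(r, t). r *\<^sub>R circ t) ` ({0..1} \<times> {0..a})"
    unfolding sector_def by (force simp: image_iff)
  then show ?thesis
    by (auto intro!: compact_continuous_image compact_Times continuous_intros simp: case_prod_unfold)
qed

text \<open>The sector integrand is averaged over rotations like the polygon's. On each circle it
  yields one gap cost of half-width \<open>a / 2 = pi / k\<close>, which is one \<open>k\<close>-th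
  of the cost of the polygon.\<close>

lemma I_fun_eq_gon_obj:
  fixes k :: nat
  assumes k: "k \<ge> 3"
  shows "real k * I_fun (2 * pi / k) = gon_obj k"
proof -
  define a where "a = 2 * pi / k"
  let ?L = "convex hull gon k 0"
  have a: "0 < a" "a < pi" using k by (auto simp: a_def field_simps)
  let ?f = "\<lambda>x. indicator (sector a) x * (infdist x (triangle a))\<^sup>2"
  have sub: "sector a \<subseteq> unit_disk" by (auto simp: sector_def unit_disk_def)
  have sec: "sector a \<in> sets borel" using compact_sector by (simp add: borel_compact)
  have f: "?f \<in> borel_measurable borel"
    using sec
    by (intro borel_measurable_times borel_measurable_indicator borel_measurable_continuous_onI
        continuous_intros)
  have B: "\<bar>?f x\<bar> \<le> 1\<^sup>2" for x
  proof (cases "x \<in> sector a")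
    case True
    have "0 \<in> triangle a" by (simp add: triangle_def hull_inc)
    then have "infdist x (triangle a) \<le> dist x 0" by (rule infdist_le)
    also have "\<dots> \<le> 1" using True sub by (auto simp: unit_disk_def)
    finally have "(infdist x (triangle a))\<^sup>2 \<le> 1\<^sup>2" by (intro power_mono infdist_nonneg)
    then show ?thesis using True by simp
  qed simp
  have ang: "integral {0..2 * pi} (\<lambda>s. ?f (r *\<^sub>R circ s)) = gap_cost r (a / 2)"
    if r: "0 \<le> r" "r \<le> 1" for r
  proof -
    have m: "a / 2 - a / 2 = 0" "a / 2 + a / 2 = a" by simp_all
    have "integral {a / 2 - a / 2..a / 2 + a / 2} (angular (triangle a) r) = gap_cost r (a / 2)"
    proof (rule integral_angular_sector)
      show "convex (triangle a)" "0 \<in> triangle a"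
        "circ (a / 2 - a / 2) \<in> triangle a" "circ (a / 2 + a / 2) \<in> triangle a"
        by (auto simp: triangle_def intro: hull_inc)
      fix y assume y: "y \<in> triangle a"
      have "0 \<le> cos (a / 2)" using a by (intro cos_ge_zero) auto
      then have "triangle a \<subseteq> {x. circ (a / 2) \<bullet> x \<le> cos (a / 2)}"
        unfolding triangle_def
        by (intro hull_minimal convex_halfspace_le) (auto simp: inner_circ)
      then show "y \<bullet> circ (a / 2) \<le> cos (a / 2)" using y by (auto simp: inner_commute)
    qed (use a r in auto)
    then have tri: "(angular (triangle a) r has_integral gap_cost r (a / 2)) {0..a}"
      unfolding m using angular_integrable integrable_integral by metis
    \<comment> \<open>For \<open>r > 0\<close> the direction \<open>2 * pi\<close> coincides with
      \<open>0\<close> and so lies in the sector although \<open>2 * pi > a\<close>; it is removed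
      as a null set.\<close>
    have f_eq: "?f (r *\<^sub>R circ s) = (if s \<le> a then angular (triangle a) r s else 0)"
      if s: "s \<in> {0..2 * pi} - {2 * pi}" for s
    \<comment> \<open>At radius 0 the point does not determine its angle; the origin lies in the
      triangle, so both sides vanish.\<close>
    proof (cases "r = 0")
      case True
      have "0 \<in> triangle a" by (simp add: triangle_def hull_inc)
      then show ?thesis using True by (simp add: angular_def)
    next
      case False
      then show ?thesis using mem_sector_iff[of r s a] s r a by (auto simp: angular_def)
    qed
    have "((\<lambda>s. if s \<in> {0..a} then angular (triangle a) r s else 0) has_integral gap_cost r (a / 2)) {0..2 * pi}"
      using tri a by (subst has_integral_restrict) auto
    then have "((\<lambda>s. ?f (r *\<^sub>R circ s)) has_integral gap_cost r (a / 2)) {0..2 * pi}"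
      by (rule has_integral_spike[of "{2 * pi}", rotated 2]) (use f_eq in auto)
    then show ?thesis by (rule integral_unique)
  qed
  have "I_fun a = (LINT x:unit_disk|lborel. ?f x) / pi"
    unfolding I_fun_def set_lebesgue_integral_def using sub
    by (simp, intro Bochner_Integration.integral_cong refl) (auto simp: indicator_def)
  also have "\<dots> = (LINT x|mu_disk. ?f x)"
    unfolding mu_disk_def using f
    by (intro integral_uniform_measure[symmetric] emeasure_unit_disk) auto
  also have "\<dots> = (LINT x|mu_disk. integral {0..2 * pi} (\<lambda>s. ?f (norm x *\<^sub>R circ s)) / (2 * pi))"
    by (rule integral_mu_disk_angular[OF f B])
  also have "\<dots> = (LINT x|mu_disk. indicator unit_disk x * (radial ?L (norm x) / (2 * pi) / k))"
  proof (intro Bochner_Integration.integral_cong refl)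
    fix x :: "real^2"
    show "integral {0..2 * pi} (\<lambda>s. ?f (norm x *\<^sub>R circ s)) / (2 * pi)
        = indicator unit_disk x * (radial ?L (norm x) / (2 * pi) / k)"
    proof (cases "x \<in> unit_disk")
      case True
      have "a / 2 = pi / k" by (simp add: a_def)
      then show ?thesis
        using True ang[of "norm x"] radial_gon[OF k, of "norm x" 0] k by (simp add: unit_disk_def)
    next
      case False
      then have "norm x *\<^sub>R circ s \<notin> sector a" for s
        using sub by (auto simp: unit_disk_def)
      then show ?thesis using False by simp
    qed
  qed
  also have "\<dots> = (LINT x|mu_disk. radial ?L (norm x) / (2 * pi) / k)"
    by (intro integral_mu_disk_indicator borel_measurable_continuous_onI continuous_intros) (use k in auto)
  finally show ?thesis using k by (simp add: gon_obj_def a_def)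
qed

section \<open>Minimizers up to rotation\<close>

lemma image_rotmat_gon: "(*v) (rotmat a) ` gon k t = gon k (t + a)"
  by (auto simp: gon_def image_image rotmat_circ algebra_simps)

theorem proposition3p1:
  fixes k :: nat
  assumes "k \<ge> 3"
  shows "{A. is_minimizer mu_disk k A} \<noteq> {}
    \<and> {A. is_minimizer mu_disk k A}
        = {mset_set (vertices P) | P. regular_polygon k P \<and> inscribed_in P unit_disk}
    \<and> (\<forall>A. is_minimizer mu_disk k A \<longrightarrow>
          (F_obj mu_disk A)\<^sup>2 = real k * I_fun (2 * pi / real k))
    \<and> (\<forall>A B. is_minimizer mu_disk k A \<and> is_minimizer mu_disk k B \<longrightarrow>
          (\<exists>Q :: real^2^2. rotation_matrix Q \<and> B = image_mset ((*v) Q) A))"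
proof -
  note min = is_minimizer_iff_gon[OF assms]
  have front: "frontier unit_disk = sphere (0 :: real^2) 1"
    by (simp add: unit_disk_def frontier_cball)
  \<comment> \<open>Being inscribed forces centre \<open>0\<close> and radius \<open>1\<close>, so
    only the phase \<open>t\<close> remains free.\<close>
  have poly: "(regular_polygon k P \<and> inscribed_in P unit_disk) \<longleftrightarrow> (\<exists>t. P = convex hull gon k t)" for P
  proof
    assume P: "regular_polygon k P \<and> inscribed_in P unit_disk"
    then obtain c r t where r: "r > 0"
      and "P = convex hull ((\<lambda>j. c + r *\<^sub>R circ (t + 2 * pi * real j / real k)) ` {..<k})"
      unfolding regular_polygon_def by blast
    then have P': "P = convex hull ((\<lambda>x. c + r *\<^sub>R x) ` gon k t)"
      by (simp add: gon_def image_image)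
    then have "(\<lambda>x. c + r *\<^sub>R x) ` gon k t \<subseteq> sphere 0 1"
      using P vertices_gon[OF r] by (simp add: inscribed_in_def front)
    from circumscribed_gon_unique[OF assms r this] P' show "\<exists>t. P = convex hull gon k t" by auto
  next
    assume "\<exists>t. P = convex hull gon k t"
    then obtain t where t: "P = convex hull gon k t" ..
    have "regular_polygon k P"
      unfolding regular_polygon_def t gon_def
      by (intro conjI assms exI[of _ 0] exI[of _ 1] exI[of _ t]) auto
    moreover have "inscribed_in P unit_disk"
      using vertices_gon[of 1 0 k t] gon_subset_sphere[of k t] by (simp add: inscribed_in_def front t)
    ultimately show "regular_polygon k P \<and> inscribed_in P unit_disk" ..
  qed
  have vert: "vertices (convex hull gon k t) = gon k t" for t
    using vertices_gon[of 1 0 k t] by simp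
  have eq: "{A. is_minimizer mu_disk k A}
      = {mset_set (vertices P) | P. regular_polygon k P \<and> inscribed_in P unit_disk}"
    unfolding min poly by (auto simp: vert) (metis vert)
  \<comment> \<open>Two phases differ by the rotation through \<open>u - t\<close>; its injectivity
    keeps all multiplicities equal to one.\<close>
  have rot: "\<exists>Q :: real^2^2. rotation_matrix Q \<and> mset_set (gon k u) = image_mset ((*v) Q) (mset_set (gon k t))"
    for t u
  proof (intro exI[of _ "rotmat (u - t)"] conjI rotation_matrix_rotmat)
    have "inj ((*v) (rotmat (u - t)))" by (rule injI) (metis rotmat_inverse)
    then show "mset_set (gon k u) = image_mset ((*v) (rotmat (u - t))) (mset_set (gon k t))"
      by (subst image_mset_mset_set) (auto intro: inj_on_subset simp: image_rotmat_gon)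
  qed
  show ?thesis
    using eq rot F_obj_gon[OF assms] I_fun_eq_gon_obj[OF assms] by (auto simp: min)
qed

end
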